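(* Let $H_1,\dots,H_N$ be complex Hilbert spaces with distinguished unit vectors $\xi_i\in H_i$, and let $G_N=(V_N,E_N)$ be a digraph (without loops) with $V_N=[N]=\{1,\dots,N\}$. Let $H=H_1\otimes\cdots\otimes H_N$, $\xi=\xi_1\otimes\cdots\otimes\xi_N$, and $\varphi(T)=\langle T\xi,\xi\rangle$ for $T\in B(H)$. Let $\pi_i:B(H_i)\to B(H)$ be the $*$-homomorphism $$\pi_i(A)=P_{i,1}\otimes\cdots\otimes P_{i,i-1}\otimes A\otimes P_{i,i+1}\otimes\cdots\otimes P_{i,N},$$ where $P_{i,j}=I_j$ if $(i,j)\in E_N$ and $P_{i,j}=P_j$ if $(i,j)\notin E_N$. Here $I_j$ is the identity operator on $H_j$ and $P_j(x)=\langle x,\xi_j\rangle\xi_j$ is the orthogonal projection onto $\mathbb{C}\xi_j$. Then the family of $*$-subalgebras $\{\pi_i(B(H_i))\}_{i=1}^N$ is BMT independent in $(B(H),\varphi)$ with respect to $G_N$.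
   Context: Inner products are linear in the first argument; $B(K)$ denotes the bounded linear operators on a Hilbert space $K$; $\otimes$ is the Hilbert space tensor product. A digraph $G=(V,E)$ has a non-empty vertex set $V$ and edge set $E\subset V\times V$ with no loops. For $\mathbf{i}=(i_1,\dots,i_m)$ with $i_k\in V$, $\ker_G[\mathbf{i}]$ is the partition of $[m]=\{1,\dots,m\}$ given by the equivalence relation: $k\sim k'$ iff $i_k=i_{k'}$ and $(i_\ell,i_k)\in E$ for every $\ell$ strictly between $k$ and $k'$ with $i_\ell\ne i_k$. BMT independence: given a complex unital algebra $\mathcal{A}$ and a linear functional $\varphi$ with $\varphi(1)=1$, a family of (not necessarily unital) subalgebras $(\mathcal{A}_i)_{i\in I}$ is BMT independent with respect to $(\varphi,G)$, $G=(I,E)$ a digraph, if for every $m\ge1$ and $a_1\in\mathcal{A}_{i_1},\dots,a_m\in\mathcal{A}_{i_m}$ one has $\varphi(a_1\cdots a_m)=\prod_{B\in\ker_G[\mathbf{i}]}\varphi((a_k)|_B)$, where $(a_k)|_B=a_{k_1}a_{k_2}\cdots a_{k_r}$ for $B=\{k_1<\cdots<k_r\}$. *)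

theory Defs
  imports
    "HOL-Analysis.Abstract_Metric_Spaces"
    "HOL-Algebra.Module"
    "Graph_Theory.Pair_Digraph"
begin

section \<open>Complex Hilbert spaces with carriers\<close>

definition complex_ring :: "complex ring" where
  "complex_ring = \<lparr>carrier = UNIV, monoid.mult = (*), one = 1, zero = 0, add = (+)\<rparr>"

text \<open>
  The spaces of a family \<open>H\<^sub>1, \<dots>, H\<^sub>N\<close> are genuinely different, so a Hilbert space is a structure
  with a carrier set and not a type class; the carriers of a family lie in one type, which is no
  restriction, as the members can be embedded in a sum type.  As usual for modules in HOL-Algebra, the fields
  \<^const>\<open>monoid.mult\<close> and \<^const>\<open>one\<close> inherited from rings carry no meaning here.
\<close>

record 'a hilbert = "(complex, 'a) module" +
  hinner :: "'a \<Rightarrow> 'a \<Rightarrow> complex"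

definition hnorm :: "('a, 'm) hilbert_scheme \<Rightarrow> 'a \<Rightarrow> real" where
  "hnorm H x = sqrt (Re (hinner H x x))"

text \<open>
  The locale \<^locale>\<open>Metric_space\<close> asks for non-negativity and symmetry on the whole type, whence the
  dummy value outside the carrier.
\<close>

definition hdist :: "('a, 'm) hilbert_scheme \<Rightarrow> 'a \<Rightarrow> 'a \<Rightarrow> real" where
  "hdist H x y = (if x \<in> carrier H \<and> y \<in> carrier H then hnorm H (x \<ominus>\<^bsub>H\<^esub> y) else 0)"

locale complex_hilbert_space = module complex_ring H for H :: "('a, 'm) hilbert_scheme" (structure) +
  assumes hinner_add_left:
      "\<lbrakk>x \<in> carrier H; y \<in> carrier H; z \<in> carrier H\<rbrakk>
        \<Longrightarrow> hinner H (x \<oplus> y) z = hinner H x z + hinner H y z"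
    and hinner_smult_left:
      "\<lbrakk>x \<in> carrier H; y \<in> carrier H\<rbrakk> \<Longrightarrow> hinner H (c \<odot> x) y = c * hinner H x y"
    and hinner_commute:
      "\<lbrakk>x \<in> carrier H; y \<in> carrier H\<rbrakk> \<Longrightarrow> hinner H x y = cnj (hinner H y x)"
    and hinner_pos:
      "\<lbrakk>x \<in> carrier H; x \<noteq> \<zero>\<rbrakk> \<Longrightarrow> Re (hinner H x x) > 0"
    and complete:
      "Metric_space.mcomplete (carrier H) (hdist H)"


section \<open>Complex algebras and bounded operators\<close>

locale complex_algebra = ring A + module complex_ring A
  for A :: "(complex, 'a, 'm) module_scheme" (structure) +
  assumes smult_mult_left:
      "\<lbrakk>x \<in> carrier A; y \<in> carrier A\<rbrakk> \<Longrightarrow> (c \<odot> x) \<otimes> y = c \<odot> (x \<otimes> y)"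
    and smult_mult_right:
      "\<lbrakk>x \<in> carrier A; y \<in> carrier A\<rbrakk> \<Longrightarrow> x \<otimes> (c \<odot> y) = c \<odot> (x \<otimes> y)"

record 'a star_algebra = "(complex, 'a) module" +
  star :: "'a \<Rightarrow> 'a"

text \<open>Subalgebras need not contain the unit, and homomorphisms need not preserve it.\<close>

definition nonunital_subalgebra :: "'a set \<Rightarrow> (complex, 'a, 'm) module_scheme \<Rightarrow> bool" where
  "nonunital_subalgebra S A \<longleftrightarrow>
    submodule S complex_ring A \<and> (\<forall>x\<in>S. \<forall>y\<in>S. x \<otimes>\<^bsub>A\<^esub> y \<in> S)"

definition star_subalgebra :: "'a set \<Rightarrow> ('a, 'm) star_algebra_scheme \<Rightarrow> bool" where
  "star_subalgebra S A \<longleftrightarrow> nonunital_subalgebra S A \<and> (\<forall>x\<in>S. star A x \<in> S)"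

definition star_hom ::
  "('a, 'm) star_algebra_scheme \<Rightarrow> ('b, 'n) star_algebra_scheme \<Rightarrow> ('a \<Rightarrow> 'b) set" where
  "star_hom A B =
    {f. f \<in> carrier A \<rightarrow> carrier B \<and>
        (\<forall>x\<in>carrier A. \<forall>y\<in>carrier A. f (x \<oplus>\<^bsub>A\<^esub> y) = f x \<oplus>\<^bsub>B\<^esub> f y) \<and>
        (\<forall>c. \<forall>x\<in>carrier A. f (c \<odot>\<^bsub>A\<^esub> x) = c \<odot>\<^bsub>B\<^esub> f x) \<and>
        (\<forall>x\<in>carrier A. \<forall>y\<in>carrier A. f (x \<otimes>\<^bsub>A\<^esub> y) = f x \<otimes>\<^bsub>B\<^esub> f y) \<and>
        (\<forall>x\<in>carrier A. f (star A x) = star B (f x))}"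

text \<open>
  Operators are functions that are \<^const>\<open>undefined\<close> outside the carrier, so that equal operators
  are equal functions.
\<close>

definition bounded_operators :: "('a, 'm) hilbert_scheme \<Rightarrow> ('a \<Rightarrow> 'a) set" where
  "bounded_operators H =
    {T \<in> carrier H \<rightarrow>\<^sub>E carrier H.
        (\<forall>x\<in>carrier H. \<forall>y\<in>carrier H. T (x \<oplus>\<^bsub>H\<^esub> y) = T x \<oplus>\<^bsub>H\<^esub> T y) \<and>
        (\<forall>c. \<forall>x\<in>carrier H. T (c \<odot>\<^bsub>H\<^esub> x) = c \<odot>\<^bsub>H\<^esub> T x) \<and>
        (\<exists>C. \<forall>x\<in>carrier H. hnorm H (T x) \<le> C * hnorm H x)}"

definition adjoint_operator :: "('a, 'm) hilbert_scheme \<Rightarrow> ('a \<Rightarrow> 'a) \<Rightarrow> 'a \<Rightarrow> 'a" where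
  "adjoint_operator H T =
    (THE S. S \<in> bounded_operators H \<and>
       (\<forall>x\<in>carrier H. \<forall>y\<in>carrier H. hinner H (T x) y = hinner H x (S y)))"

definition id_operator :: "('a, 'm) hilbert_scheme \<Rightarrow> 'a \<Rightarrow> 'a" where
  "id_operator H = (\<lambda>x\<in>carrier H. x)"

definition rank_one_projection :: "('a, 'm) hilbert_scheme \<Rightarrow> 'a \<Rightarrow> 'a \<Rightarrow> 'a" where
  "rank_one_projection H \<xi> = (\<lambda>x\<in>carrier H. hinner H x \<xi> \<odot>\<^bsub>H\<^esub> \<xi>)"

definition B_algebra :: "('a, 'm) hilbert_scheme \<Rightarrow> ('a \<Rightarrow> 'a) star_algebra" where
  "B_algebra H =
    \<lparr>carrier = bounded_operators H,
     monoid.mult = compose (carrier H),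
     one = id_operator H,
     zero = (\<lambda>x\<in>carrier H. \<zero>\<^bsub>H\<^esub>),
     add = (\<lambda>S T. \<lambda>x\<in>carrier H. S x \<oplus>\<^bsub>H\<^esub> T x),
     smult = (\<lambda>c T. \<lambda>x\<in>carrier H. c \<odot>\<^bsub>H\<^esub> T x),
     star = adjoint_operator H\<rparr>"

definition vector_state :: "('a, 'm) hilbert_scheme \<Rightarrow> 'a \<Rightarrow> ('a \<Rightarrow> 'a) \<Rightarrow> complex" where
  "vector_state H \<xi> T = hinner H (T \<xi>) \<xi>"


section \<open>Hilbert space tensor products\<close>

text \<open>
  \<open>K\<close> with the elementary tensors \<open>tens x = \<Otimes>\<^sub>j x\<^sub>j\<close> is a Hilbert space tensor product of the
  \<open>H\<^sub>j\<close>, i.e. a completion of their algebraic tensor product for the inner product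
  \<open>\<langle>\<Otimes>\<^sub>j x\<^sub>j, \<Otimes>\<^sub>j y\<^sub>j\<rangle> = \<Prod>\<^sub>j \<langle>x\<^sub>j, y\<^sub>j\<rangle>\<close>.  As this form is positive definite on the algebraic tensor
  product, the span of the elementary tensors in \<open>K\<close> is a copy of the latter.  The pair
  \<open>(K, tens)\<close> is determined up to a unique unitary.
\<close>

locale hilbert_tensor_product =
  fixes J :: "'i set"
    and H :: "'i \<Rightarrow> ('a, 'm) hilbert_scheme"
    and K :: "('b, 'n) hilbert_scheme"
    and tens :: "('i \<Rightarrow> 'a) \<Rightarrow> 'b"
  assumes finite_index: "finite J"
    and hilbert_factor: "j \<in> J \<Longrightarrow> complex_hilbert_space (H j)"
    and hilbert_tensor: "complex_hilbert_space K"
    and tens_closed: "tens \<in> (\<Pi>\<^sub>E j\<in>J. carrier (H j)) \<rightarrow> carrier K"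
    and tens_add:
      "\<lbrakk>x \<in> (\<Pi>\<^sub>E j\<in>J. carrier (H j)); j \<in> J; u \<in> carrier (H j); v \<in> carrier (H j)\<rbrakk>
        \<Longrightarrow> tens (x(j := u \<oplus>\<^bsub>H j\<^esub> v)) = tens (x(j := u)) \<oplus>\<^bsub>K\<^esub> tens (x(j := v))"
    and tens_smult:
      "\<lbrakk>x \<in> (\<Pi>\<^sub>E j\<in>J. carrier (H j)); j \<in> J; u \<in> carrier (H j)\<rbrakk>
        \<Longrightarrow> tens (x(j := c \<odot>\<^bsub>H j\<^esub> u)) = c \<odot>\<^bsub>K\<^esub> tens (x(j := u))"
    and hinner_tens:
      "\<lbrakk>x \<in> (\<Pi>\<^sub>E j\<in>J. carrier (H j)); y \<in> (\<Pi>\<^sub>E j\<in>J. carrier (H j))\<rbrakk>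
        \<Longrightarrow> hinner K (tens x) (tens y) = (\<Prod>j\<in>J. hinner (H j) (x j) (y j))"
    and tens_total:
      "Metric_space.mtopology (carrier K) (hdist K) closure_of
         ((\<lambda>S. submodule S complex_ring K) hull (tens ` (\<Pi>\<^sub>E j\<in>J. carrier (H j)))) = carrier K"

text \<open>
  \<open>\<Otimes>\<^sub>j A\<^sub>j\<close> is the bounded operator on \<open>K\<close> with
  \<open>(\<Otimes>\<^sub>j A\<^sub>j)(\<Otimes>\<^sub>j x\<^sub>j) = \<Otimes>\<^sub>j A\<^sub>j x\<^sub>j\<close>.
\<close>

definition tensor_operator ::
  "'i set \<Rightarrow> ('i \<Rightarrow> ('a, 'm) hilbert_scheme) \<Rightarrow> ('b, 'n) hilbert_scheme \<Rightarrow> (('i \<Rightarrow> 'a) \<Rightarrow> 'b)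
    \<Rightarrow> ('i \<Rightarrow> 'a \<Rightarrow> 'a) \<Rightarrow> 'b \<Rightarrow> 'b" where
  "tensor_operator J H K tens A =
    (THE T. T \<in> bounded_operators K \<and>
       (\<forall>x \<in> (\<Pi>\<^sub>E j\<in>J. carrier (H j)). T (tens x) = tens (\<lambda>j\<in>J. A j (x j))))"


section \<open>BMT independence\<close>

definition nonempty_digraph :: "'i pair_pre_digraph \<Rightarrow> bool" where
  "nonempty_digraph G \<longleftrightarrow> pair_loopfree_digraph G \<and> pverts G \<noteq> {}"

definition ker_rel :: "'i pair_pre_digraph \<Rightarrow> nat \<Rightarrow> (nat \<Rightarrow> 'i) \<Rightarrow> nat rel" where
  "ker_rel G m i =
    {(k, k'). k \<in> {1..m} \<and> k' \<in> {1..m} \<and> i k = i k' \<and>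
       (\<forall>l. min k k' < l \<and> l < max k k' \<and> i l \<noteq> i k \<longrightarrow> (i l, i k) \<in> parcs G)}"

definition ker_partition :: "'i pair_pre_digraph \<Rightarrow> nat \<Rightarrow> (nat \<Rightarrow> 'i) \<Rightarrow> nat set set" where
  "ker_partition G m i = {1..m} // ker_rel G m i"

definition ordered_prod :: "('a, 'm) monoid_scheme \<Rightarrow> (nat \<Rightarrow> 'a) \<Rightarrow> nat set \<Rightarrow> 'a" where
  "ordered_prod A a B = foldr (monoid.mult A) (map a (sorted_list_of_set B)) (one A)"

locale algebraic_probability_space = complex_algebra A
  for A :: "(complex, 'a, 'm) module_scheme" (structure) +
  fixes \<phi> :: "'a \<Rightarrow> complex"
  assumes state_add: "\<lbrakk>x \<in> carrier A; y \<in> carrier A\<rbrakk> \<Longrightarrow> \<phi> (x \<oplus> y) = \<phi> x + \<phi> y"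
    and state_smult: "x \<in> carrier A \<Longrightarrow> \<phi> (c \<odot> x) = c * \<phi> x"
    and state_one: "\<phi> \<one> = 1"

definition BMT_independent ::
  "(complex, 'a, 'm) module_scheme \<Rightarrow> ('a \<Rightarrow> complex) \<Rightarrow> 'i pair_pre_digraph \<Rightarrow> ('i \<Rightarrow> 'a set) \<Rightarrow> bool"
  where
  "BMT_independent A \<phi> G S \<longleftrightarrow>
    algebraic_probability_space A \<phi> \<and> nonempty_digraph G \<and>
    (\<forall>i\<in>pverts G. nonunital_subalgebra (S i) A) \<and>
    (\<forall>m\<ge>1. \<forall>i a. (\<forall>k\<in>{1..m}. i k \<in> pverts G \<and> a k \<in> S (i k)) \<longrightarrow>
       \<phi> (ordered_prod A a {1..m}) = (\<Prod>B\<in>ker_partition G m i. \<phi> (ordered_prod A a B)))"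


section \<open>The representations on the tensor product\<close>

definition BMT_rep ::
  "nat pair_pre_digraph \<Rightarrow> (nat \<Rightarrow> ('a, 'm) hilbert_scheme) \<Rightarrow> (nat \<Rightarrow> 'a)
    \<Rightarrow> ('b, 'n) hilbert_scheme \<Rightarrow> ((nat \<Rightarrow> 'a) \<Rightarrow> 'b) \<Rightarrow> nat \<Rightarrow> ('a \<Rightarrow> 'a) \<Rightarrow> 'b \<Rightarrow> 'b" where
  "BMT_rep G H \<xi> K tens i A =
    tensor_operator (pverts G) H K tens
      (\<lambda>j. if j = i then A
           else if (i, j) \<in> parcs G then id_operator (H j)
           else rank_one_projection (H j) (\<xi> j))"

end

(*
  In the j-th tensor factor, a product of the represented operators becomes a word in which the
  operators of colour j are separated by identities and by projections onto the line of xi_j. The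
  projections cut the vacuum expectation of this word into a product over the blocks between
  consecutive cuts, and the blocks of all colours together are the blocks of the kernel partition.
*)

theory Submission
  imports Defs
begin

section \<open>Hilbert spaces\<close>

text \<open>The analytic work lies in the objects themselves: adjoints and tensor products of
  operators are definite descriptions, so each needs existence and uniqueness before it can be
  computed with. \<open>K\<close> is known only through elementary tensors with dense span, and a
  finite sum of them has no canonical form. The triangle inequality bounds \<Sum> c_l \<Otimes> A_j
  x_lj by the sizes of its terms, but not by the norm of \<Sum> c_l \<Otimes> x_lj, which
  cancellation can make small. A growth estimate for iterates of A_j followed by its adjoint closes
  this gap. The extended operator is then described by inner products against elementary tensors, so
  that its linearity and uniqueness rest on the fact that these separate vectors. On the
  combinatorial side, the kernel relation becomes equality of values of the map sending a position
  to its colour and the number of earlier cuts for that colour, and its classes are the fibres of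
  this map.\<close>

lemma complex_ring_simps [simp]:
  "carrier complex_ring = UNIV" "monoid.mult complex_ring = (*)" "one complex_ring = 1"
  "zero complex_ring = 0" "add complex_ring = (+)"
  by (simp_all add: complex_ring_def)

text \<open>The ring minus is a description of an additive inverse, so it can be evaluated only
  after the ring axioms are in place.\<close>

lemma complex_ring_minus [simp]: "\<ominus>\<^bsub>complex_ring\<^esub> a = - a"
proof -
  have "cring complex_ring"
  proof (rule cringI)
    have "\<exists>y. y + x = 0" for x :: complex
      by (rule exI[of _ "- x"]) simp
    then show "abelian_group complex_ring"
      by (intro abelian_groupI) (simp_all add: add_ac)
    show "comm_monoid complex_ring"
      by (intro comm_monoidI) simp_all
  qed (simp add: distrib_right)
  then interpret cring complex_ring .
  show ?thesis
    by (rule minus_equality) auto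
qed

section \<open>Algebra and geometry of the inner product\<close>

context complex_hilbert_space
begin

lemma complex_smult_closed [simp, intro]: "x \<in> carrier H \<Longrightarrow> c \<odot> x \<in> carrier H"
  using smult_closed by simp

lemma complex_smult_distribs:
  "x \<in> carrier H \<Longrightarrow> (a + b) \<odot> x = a \<odot> x \<oplus> b \<odot> x"
  "x \<in> carrier H \<Longrightarrow> y \<in> carrier H \<Longrightarrow> a \<odot> (x \<oplus> y) = a \<odot> x \<oplus> a \<odot> y"
  "x \<in> carrier H \<Longrightarrow> (a * b) \<odot> x = a \<odot> (b \<odot> x)"
  using smult_l_distr smult_r_distr smult_assoc1 by simp_all

lemma complex_smult_one [simp]: "x \<in> carrier H \<Longrightarrow> 1 \<odot> x = x"
  using smult_one by simp

lemma complex_smult_zero [simp]: "x \<in> carrier H \<Longrightarrow> 0 \<odot> x = \<zero>" "c \<odot> \<zero> = \<zero>"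
  using smult_l_null smult_r_null by simp_all

lemma minus_one_smult: "x \<in> carrier H \<Longrightarrow> (-1) \<odot> x = \<ominus> x"
  using smult_l_minus[of 1 x] by simp

lemma diff_conv_smult: "x \<in> carrier H \<Longrightarrow> y \<in> carrier H \<Longrightarrow> x \<ominus> y = x \<oplus> (-1) \<odot> y"
  by (simp add: minus_one_smult M.minus_eq)

lemma diff_zero [simp]: "x \<in> carrier H \<Longrightarrow> x \<ominus> \<zero> = x"
  by (simp add: diff_conv_smult)

lemma diff_eq_zero_iff: "x \<in> carrier H \<Longrightarrow> y \<in> carrier H \<Longrightarrow> x \<ominus> y = \<zero> \<longleftrightarrow> x = y"
  by (metis M.add.inv_closed M.add.inv_solve_right M.l_zero M.minus_eq M.r_neg M.zero_closed)

lemma hinner_add_right: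
  "\<lbrakk>x \<in> carrier H; y \<in> carrier H; z \<in> carrier H\<rbrakk> \<Longrightarrow> hinner H x (y \<oplus> z) = hinner H x y + hinner H x z"
  using hinner_commute[of x] hinner_add_left[of y z x]
  by (metis M.add.m_closed complex_cnj_add hinner_commute)

lemma hinner_smult_right:
  "\<lbrakk>x \<in> carrier H; y \<in> carrier H\<rbrakk> \<Longrightarrow> hinner H x (c \<odot> y) = cnj c * hinner H x y"
  by (metis complex_cnj_mult complex_smult_closed hinner_commute hinner_smult_left)

lemma hinner_zero [simp]:
  assumes "x \<in> carrier H" shows "hinner H \<zero> x = 0" "hinner H x \<zero> = 0"
  using assms hinner_smult_left[of \<zero> x 0] hinner_smult_right[of x \<zero> 0] by simp_all

lemma hinner_diff_left:
  "\<lbrakk>x \<in> carrier H; y \<in> carrier H; z \<in> carrier H\<rbrakk> \<Longrightarrow> hinner H (x \<ominus> y) z = hinner H x z - hinner H y z"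
  by (simp add: diff_conv_smult hinner_add_left hinner_smult_left)

lemma hinner_diff_right:
  "\<lbrakk>x \<in> carrier H; y \<in> carrier H; z \<in> carrier H\<rbrakk> \<Longrightarrow> hinner H z (x \<ominus> y) = hinner H z x - hinner H z y"
  by (simp add: diff_conv_smult hinner_add_right hinner_smult_right)

lemmas hinner_simps = hinner_add_left hinner_add_right hinner_smult_left hinner_smult_right
  hinner_diff_left hinner_diff_right

lemma hinner_self_nonneg: "x \<in> carrier H \<Longrightarrow> 0 \<le> Re (hinner H x x)"
  using hinner_pos[of x] by (cases "x = \<zero>") auto

lemma hnorm_nonneg: "x \<in> carrier H \<Longrightarrow> 0 \<le> hnorm H x"
  by (simp add: hnorm_def hinner_self_nonneg)

lemma hnorm_sq: "x \<in> carrier H \<Longrightarrow> (hnorm H x)\<^sup>2 = Re (hinner H x x)"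
  by (simp add: hnorm_def hinner_self_nonneg)

lemma hinner_self: "x \<in> carrier H \<Longrightarrow> hinner H x x = of_real ((hnorm H x)\<^sup>2)"
  using hinner_commute[of x x] by (simp add: hnorm_sq complex_eq_iff)

lemma hnorm_eq_0_iff: "x \<in> carrier H \<Longrightarrow> hnorm H x = 0 \<longleftrightarrow> x = \<zero>"
  using hinner_pos[of x] by (cases "x = \<zero>") (auto simp: hnorm_def)

lemma hnorm_smult: "x \<in> carrier H \<Longrightarrow> hnorm H (c \<odot> x) = cmod c * hnorm H x"
proof -
  assume x: "x \<in> carrier H"
  have "hinner H (c \<odot> x) (c \<odot> x) = of_real ((cmod c * hnorm H x)\<^sup>2)"
    using x complex_norm_square[of c] by (simp add: hinner_smult_left hinner_smult_right)
      (simp add: hinner_self power_mult_distrib mult.commute)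
  then have "(hnorm H (c \<odot> x))\<^sup>2 = (cmod c * hnorm H x)\<^sup>2"
    using x by (simp add: hnorm_sq del: of_real_power)
  then show ?thesis using x by (simp add: hnorm_nonneg)
qed

lemma Cauchy_Schwarz:
  assumes x: "x \<in> carrier H" and y: "y \<in> carrier H"
  shows "cmod (hinner H x y) \<le> hnorm H x * hnorm H y"
proof (cases "y = \<zero>")
  case True
  then show ?thesis using x y by (simp add: hnorm_nonneg)
next
  case False
  define b where "b = (hnorm H y)\<^sup>2"
  define p where "p = hinner H x y"
  have b: "b > 0" using False y hnorm_eq_0_iff hnorm_nonneg[of y] by (simp add: b_def)
  have yx: "hinner H y x = cnj p" using hinner_commute[OF y x] by (simp add: p_def)
  \<comment> \<open>\<open>z\<close> is \<open>b\<close> times the component of \<open>x\<close>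
    orthogonal to \<open>y\<close>; the scaling keeps the computation free of division.\<close>
  define z where "z = of_real b \<odot> x \<ominus> p \<odot> y"
  have xx: "hinner H x x = of_real ((hnorm H x)\<^sup>2)" and yy: "hinner H y y = of_real b"
    using x y by (simp_all only: hinner_self b_def)
  have "hinner H z z = of_real b * (of_real b * of_real ((hnorm H x)\<^sup>2) - p * cnj p)"
    unfolding z_def using x y
    by (simp only: hinner_simps xx yy yx p_def[symmetric] complex_smult_closed M.minus_closed
        complex_cnj_complex_of_real)
      (simp add: algebra_simps)
  also have "\<dots> = of_real (b * (b * (hnorm H x)\<^sup>2 - (cmod p)\<^sup>2))"
    by (simp only: complex_norm_square[symmetric] of_real_mult of_real_diff)
  finally have z: "hinner H z z = of_real (b * (b * (hnorm H x)\<^sup>2 - (cmod p)\<^sup>2))" .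
  then have "0 \<le> b * (b * (hnorm H x)\<^sup>2 - (cmod p)\<^sup>2)"
    using hinner_self_nonneg[of z] x y unfolding z by (simp add: z_def)
  then have "(cmod p)\<^sup>2 \<le> (hnorm H x * hnorm H y)\<^sup>2"
    using b by (simp add: zero_le_mult_iff b_def power_mult_distrib mult.commute)
  then show ?thesis
    using power2_le_imp_le x y hnorm_nonneg by (simp add: p_def)
qed

lemma hnorm_triangle:
  assumes x: "x \<in> carrier H" and y: "y \<in> carrier H"
  shows "hnorm H (x \<oplus> y) \<le> hnorm H x + hnorm H y"
proof -
  have "(hnorm H (x \<oplus> y))\<^sup>2 = (hnorm H x)\<^sup>2 + 2 * Re (hinner H x y) + (hnorm H y)\<^sup>2"
    using x y hinner_commute[of y x] by (simp add: hnorm_sq hinner_simps)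
  also have "\<dots> \<le> (hnorm H x + hnorm H y)\<^sup>2"
    using Cauchy_Schwarz[OF x y] complex_Re_le_cmod[of "hinner H x y"]
    by (simp add: power2_sum)
  finally show ?thesis
    using power2_le_imp_le x y hnorm_nonneg by simp
qed

lemma hnorm_diff_commute: "\<lbrakk>x \<in> carrier H; y \<in> carrier H\<rbrakk> \<Longrightarrow> hnorm H (x \<ominus> y) = hnorm H (y \<ominus> x)"
  by (simp add: hnorm_def hinner_simps algebra_simps)

lemma hnorm_diff_triangle:
  assumes "x \<in> carrier H" "y \<in> carrier H" "z \<in> carrier H"
  shows "hnorm H (x \<ominus> z) \<le> hnorm H (x \<ominus> y) + hnorm H (y \<ominus> z)"
proof -
  have "x \<ominus> z = (x \<ominus> y) \<oplus> (y \<ominus> z)"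
    using assms by (simp add: M.minus_eq M.a_assoc M.r_neg1)
  then show ?thesis using hnorm_triangle assms by simp
qed

section \<open>Completeness and limits in norm\<close>

sublocale hilbert_metric: Metric_space "carrier H" "hdist H"
proof
  show "0 \<le> hdist H x y" for x y by (simp add: hdist_def hnorm_nonneg)
  show "hdist H x y = hdist H y x" for x y by (simp add: hdist_def hnorm_diff_commute)
  show "hdist H x y = 0 \<longleftrightarrow> x = y" if "x \<in> carrier H" "y \<in> carrier H" for x y
    using that by (simp add: hdist_def hnorm_eq_0_iff diff_eq_zero_iff)
  show "hdist H x z \<le> hdist H x y + hdist H y z"
    if "x \<in> carrier H" "y \<in> carrier H" "z \<in> carrier H" for x y z
    using that by (simp add: hdist_def hnorm_diff_triangle)
qed

text \<open>Completeness for \<open>hdist\<close>, restated for norms of differences so that later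
  arguments avoid the metric and its dummy value off the carrier.\<close>

lemma Cauchy_sequence_limit:
  assumes x: "\<And>n::nat. x n \<in> carrier H"
    and C: "\<And>e. e > 0 \<Longrightarrow> \<exists>N. \<forall>m\<ge>N. \<forall>n\<ge>N. hnorm H (x m \<ominus> x n) < e"
  obtains l where "l \<in> carrier H" "(\<lambda>n. hnorm H (x n \<ominus> l)) \<longlonglongrightarrow> 0"
proof -
  have "hilbert_metric.MCauchy x"
    unfolding hilbert_metric.MCauchy_def using x C by (auto simp: hdist_def)
  then obtain l where l: "limitin hilbert_metric.mtopology x l sequentially"
    using complete hilbert_metric.mcomplete_def by blast
  then have lc: "l \<in> carrier H" and "(\<lambda>n. hdist H (x n) l) \<longlonglongrightarrow> 0"
    by (simp_all add: hilbert_metric.limitin_metric_dist_null)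
  then have "(\<lambda>n. hnorm H (x n \<ominus> l)) \<longlonglongrightarrow> 0"
    using x by (simp add: hdist_def)
  with lc that show thesis by blast
qed

lemma hinner_tendsto:
  assumes x: "\<And>n::nat. x n \<in> carrier H" and l: "l \<in> carrier H" and y: "y \<in> carrier H"
    and lim: "(\<lambda>n. hnorm H (x n \<ominus> l)) \<longlonglongrightarrow> 0"
  shows "(\<lambda>n. hinner H (x n) y) \<longlonglongrightarrow> hinner H l y"
proof -
  have "(\<lambda>n. hinner H (x n) y - hinner H l y) \<longlonglongrightarrow> 0"
  proof (rule Lim_null_comparison)
    show "\<forall>\<^sub>F n in sequentially. norm (hinner H (x n) y - hinner H l y)
            \<le> hnorm H (x n \<ominus> l) * hnorm H y"
      using Cauchy_Schwarz[of "x _ \<ominus> l" y] x l y by (simp add: hinner_simps)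
    show "(\<lambda>n. hnorm H (x n \<ominus> l) * hnorm H y) \<longlonglongrightarrow> 0"
      using tendsto_mult[OF lim tendsto_const] by simp
  qed
  then show ?thesis by (simp add: LIM_zero_iff)
qed

lemma hnorm_tendsto:
  assumes x: "\<And>n::nat. x n \<in> carrier H" and l: "l \<in> carrier H"
    and lim: "(\<lambda>n. hnorm H (x n \<ominus> l)) \<longlonglongrightarrow> 0"
  shows "(\<lambda>n. hnorm H (x n)) \<longlonglongrightarrow> hnorm H l"
proof -
  have "\<bar>hnorm H (x n) - hnorm H l\<bar> \<le> hnorm H (x n \<ominus> l)" for n
    using hnorm_diff_triangle[of "x n" l \<zero>] hnorm_diff_triangle[of l "x n" \<zero>] x[of n] l
      hnorm_diff_commute[of l "x n"]
    by simp
  then have "(\<lambda>n. hnorm H (x n) - hnorm H l) \<longlonglongrightarrow> 0"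
    by (intro Lim_null_comparison[OF _ lim]) simp
  then show ?thesis by (simp add: LIM_zero_iff)
qed

lemma hinner_left_eqI:
  assumes "x \<in> carrier H" "y \<in> carrier H" "\<And>z. z \<in> carrier H \<Longrightarrow> hinner H x z = hinner H y z"
  shows "x = y"
proof -
  have "hinner H (x \<ominus> y) (x \<ominus> y) = 0" using assms by (simp add: hinner_diff_left)
  then have "x \<ominus> y = \<zero>" using assms hinner_self[of "x \<ominus> y"] hnorm_eq_0_iff by simp
  then show ?thesis using assms by (simp add: diff_eq_zero_iff)
qed

lemma hinner_right_eqI:
  assumes "x \<in> carrier H" "y \<in> carrier H" "\<And>z. z \<in> carrier H \<Longrightarrow> hinner H z x = hinner H z y"
  shows "x = y"
  using assms hinner_left_eqI[of x y] hinner_commute by metis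

text \<open>
  The representing vector is the limit of a minimising sequence of \<open>\<parallel>x\<parallel>\<^sup>2 - 2 Re f x\<close>, which is
  Cauchy by the parallelogram law.
\<close>

lemma Riesz_representation:
  fixes f :: "'a \<Rightarrow> complex"
  assumes add: "\<And>x y. x \<in> carrier H \<Longrightarrow> y \<in> carrier H \<Longrightarrow> f (x \<oplus> y) = f x + f y"
    and smult: "\<And>c x. x \<in> carrier H \<Longrightarrow> f (c \<odot> x) = c * f x"
    and bdd: "\<And>x. x \<in> carrier H \<Longrightarrow> cmod (f x) \<le> C * hnorm H x"
  obtains z where "z \<in> carrier H" "\<And>x. x \<in> carrier H \<Longrightarrow> f x = hinner H x z"
proof -
  define Q where "Q x = (hnorm H x)\<^sup>2 - 2 * Re (f x)" for x
  define d where "d = Inf (Q ` carrier H)"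
  \<comment> \<open>Completing the square: |f x| \<le> C |x| gives Q x \<ge> (|x| - C)^2 -
    C^2.\<close>
  have Qlow: "- C\<^sup>2 \<le> Q x" if "x \<in> carrier H" for x
  proof -
    have "0 \<le> (hnorm H x - C)\<^sup>2" by simp
    then show ?thesis
      using bdd[OF that] complex_Re_le_cmod[of "f x"] by (simp add: Q_def power2_diff algebra_simps)
  qed
  then have below: "bdd_below (Q ` carrier H)" by (auto simp: bdd_below_def)
  have d_le: "d \<le> Q x" if "x \<in> carrier H" for x
    unfolding d_def using below that by (simp add: cInf_lower)
  have "\<exists>x\<in>carrier H. Q x < d + inverse (real (Suc n))" for n
    using cInf_lessD[of "Q ` carrier H" "d + inverse (real (Suc n))"] M.zero_closed
    by (auto simp: d_def)
  then obtain x where x: "\<And>n. x n \<in> carrier H" and Qx: "\<And>n. Q (x n) < d + inverse (real (Suc n))"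
    by metis
  have diff: "(hnorm H (u \<ominus> v))\<^sup>2 \<le> 2 * (Q u - d) + 2 * (Q v - d)"
    if u: "u \<in> carrier H" and v: "v \<in> carrier H" for u v
  proof -
    \<comment> \<open>Testing \<open>d\<close> at the midpoint of \<open>u\<close> and
      \<open>v\<close> supplies the |u + v|^2 term of the parallelogram law.\<close>
    have "4 * d \<le> 4 * Q ((1/2) \<odot> (u \<oplus> v))" using d_le u v by simp
    also have "\<dots> = Re (hinner H (u \<oplus> v) (u \<oplus> v)) - 4 * Re (f u) - 4 * Re (f v)"
      using u v by (simp add: Q_def hnorm_sq smult add hinner_smult_left hinner_smult_right field_simps)
    finally show ?thesis
      using u v by (simp add: Q_def hnorm_sq hinner_simps)
  qed
  have C: "\<exists>N. \<forall>m\<ge>N. \<forall>n\<ge>N. hnorm H (x m \<ominus> x n) < e" if e: "e > 0" for e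
  proof -
    obtain N where N: "inverse (real (Suc N)) < e\<^sup>2 / 4"
      using reals_Archimedean[of "e\<^sup>2 / 4"] e by auto
    have "hnorm H (x m \<ominus> x n) < e" if "m \<ge> N" "n \<ge> N" for m n
    proof -
      have "inverse (real (Suc m)) \<le> inverse (real (Suc N))"
        "inverse (real (Suc n)) \<le> inverse (real (Suc N))"
        using that by (auto intro: le_imp_inverse_le)
      moreover have "a < e\<^sup>2" if "r \<le> t" "s \<le> t" "a \<le> 2 * (p - d) + 2 * (q - d)"
        "p < d + r" "q < d + s" "t < e\<^sup>2 / 4" for a p q r s t :: real
      proof -
        have "4 * t < e\<^sup>2" using that(6) by simp
        then show ?thesis using that(1-5) by argo
      qed
      ultimately have "(hnorm H (x m \<ominus> x n))\<^sup>2 < e\<^sup>2"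
        using diff[OF x x, of m n] Qx[of m] Qx[of n] N by blast
      then show ?thesis using e by (simp add: power2_less_imp_less)
    qed
    then show ?thesis by blast
  qed
  obtain l where l: "l \<in> carrier H" and lim: "(\<lambda>n. hnorm H (x n \<ominus> l)) \<longlonglongrightarrow> 0"
    by (rule Cauchy_sequence_limit[of x, OF x C])
  have re: "Re (f h) = Re (hinner H h l)" if h: "h \<in> carrier H" for h
  proof -
    define a where "a = (hnorm H h)\<^sup>2"
    define b where "b = Re (hinner H l h) - Re (f h)"
    \<comment> \<open>First-order condition along \<open>h\<close>: \<open>d\<close> is compared
      with \<open>Q\<close> at x n + t h and the inequality is passed to the limit, so it need not
      be shown that \<open>l\<close> attains the infimum.\<close>
    have quad: "0 \<le> t\<^sup>2 * a + 2 * t * b" for t :: real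
    proof (rule LIMSEQ_le_const)
      have "(\<lambda>n. t\<^sup>2 * a + 2 * t * (Re (hinner H (x n) h) - Re (f h)) + inverse (real (Suc n)))
          \<longlonglongrightarrow> t\<^sup>2 * a + 2 * t * b + 0"
        unfolding b_def
        by (intro tendsto_add tendsto_mult tendsto_const tendsto_diff tendsto_Re
            LIMSEQ_inverse_real_of_nat hinner_tendsto[of x l h, OF x l h lim])
      then show "(\<lambda>n. t\<^sup>2 * a + 2 * t * (Re (hinner H (x n) h) - Re (f h)) + inverse (real (Suc n)))
          \<longlonglongrightarrow> t\<^sup>2 * a + 2 * t * b" by simp
    next
      show "\<exists>N. \<forall>n\<ge>N. 0 \<le> t\<^sup>2 * a + 2 * t * (Re (hinner H (x n) h) - Re (f h)) + inverse (real (Suc n))"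
      proof (intro exI allI impI)
        fix n
        have "d \<le> Q (x n \<oplus> of_real t \<odot> h)" using d_le x h by simp
        also have "\<dots> = Q (x n) + t\<^sup>2 * a + 2 * t * (Re (hinner H (x n) h) - Re (f h))"
          using x h hinner_commute[of h "x n"]
          by (simp add: Q_def a_def hnorm_sq hinner_simps add smult)
            (simp add: power2_eq_square algebra_simps)
        finally show "0 \<le> t\<^sup>2 * a + 2 * t * (Re (hinner H (x n) h) - Re (f h)) + inverse (real (Suc n))"
          using Qx[of n] by linarith
      qed
    qed
    have "b = 0"
    proof (rule ccontr)
      assume "b \<noteq> 0"
      have a: "a \<ge> 0" by (simp add: a_def)
      \<comment> \<open>The quadratic is tested at t = -b/k; the added 1 keeps \<open>k\<close>
        positive when \<open>h\<close> is zero.\<close>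
      define k where "k = a + 1"
      then have k: "a = k - 1" "k \<ge> 1" using a by simp_all
      have "0 \<le> (- b / k)\<^sup>2 * a + 2 * (- b / k) * b" by (rule quad)
      also have "\<dots> = - (b\<^sup>2 * (k + 1)) / k\<^sup>2"
        using k(2) unfolding k(1) by (simp add: field_simps power2_eq_square)
      also have "\<dots> < 0" using k \<open>b \<noteq> 0\<close> by (simp add: divide_less_0_iff)
      finally show False by simp
    qed
    then show ?thesis using hinner_commute[of h l] h l by (simp add: b_def)
  qed
  have "f h = hinner H h l" if h: "h \<in> carrier H" for h
  proof (rule complex_eqI)
    \<comment> \<open>The imaginary part of a linear functional at \<open>h\<close> is its real part
      at -i h.\<close>
    show "Im (f h) = Im (hinner H h l)"
      using re[of "- \<i> \<odot> h"] h l by (simp add: smult hinner_smult_left)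
  qed (use re h in simp)
  with l that show thesis by blast
qed

end


section \<open>Bounded operators\<close>

context complex_hilbert_space
begin

lemma bounded_operatorsI:
  assumes "T \<in> carrier H \<rightarrow>\<^sub>E carrier H"
    and "\<And>x y. x \<in> carrier H \<Longrightarrow> y \<in> carrier H \<Longrightarrow> T (x \<oplus> y) = T x \<oplus> T y"
    and "\<And>c x. x \<in> carrier H \<Longrightarrow> T (c \<odot> x) = c \<odot> T x"
    and "\<And>x. x \<in> carrier H \<Longrightarrow> hnorm H (T x) \<le> C * hnorm H x"
  shows "T \<in> bounded_operators H"
  unfolding bounded_operators_def by (intro CollectI conjI allI ballI exI[of _ C] assms)

lemma bounded_operatorsD:
  assumes "T \<in> bounded_operators H"
  shows bounded_operator_PiE: "T \<in> carrier H \<rightarrow>\<^sub>E carrier H"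
    and bounded_operator_closed: "x \<in> carrier H \<Longrightarrow> T x \<in> carrier H"
    and bounded_operator_add: "x \<in> carrier H \<Longrightarrow> y \<in> carrier H \<Longrightarrow> T (x \<oplus> y) = T x \<oplus> T y"
    and bounded_operator_smult: "x \<in> carrier H \<Longrightarrow> T (c \<odot> x) = c \<odot> T x"
  using assms by (auto simp: bounded_operators_def)

lemma bounded_operator_bound:
  assumes "T \<in> bounded_operators H"
  obtains C where "C \<ge> 0" "\<And>x. x \<in> carrier H \<Longrightarrow> hnorm H (T x) \<le> C * hnorm H x"
proof -
  obtain C where C: "\<And>x. x \<in> carrier H \<Longrightarrow> hnorm H (T x) \<le> C * hnorm H x"
    using assms unfolding bounded_operators_def by fast
  have "hnorm H (T x) \<le> \<bar>C\<bar> * hnorm H x" if "x \<in> carrier H" for x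
  proof -
    have "C * hnorm H x \<le> \<bar>C\<bar> * hnorm H x"
      using hnorm_nonneg[OF that] by (intro mult_right_mono) auto
    with C[OF that] show ?thesis by linarith
  qed
  with that[of "\<bar>C\<bar>"] show thesis by simp
qed

lemma bounded_operator_eqI:
  assumes "S \<in> bounded_operators H" "T \<in> bounded_operators H"
    and "\<And>x. x \<in> carrier H \<Longrightarrow> S x = T x"
  shows "S = T"
  by (rule PiE_ext[OF assms(1,2)[THEN bounded_operator_PiE] assms(3)])

lemma restrict_eq_operatorI:
  assumes "T \<in> bounded_operators H" "\<And>x. x \<in> carrier H \<Longrightarrow> f x = T x"
  shows "restrict f (carrier H) = T"
proof -
  have "restrict f (carrier H) = restrict T (carrier H)" by (rule restrict_ext) (rule assms(2))
  also have "\<dots> = T"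
    using bounded_operator_PiE[OF assms(1)] by (auto simp: PiE_iff extensional_restrict)
  finally show ?thesis .
qed

text \<open>A formal adjoint is automatically linear, because inner products determine vectors, and
  it inherits the bound of \<open>T\<close> from |S x|^2 = <T (S x), x> \<le> C |S x| |x|.\<close>

lemma bounded_operatorI_adjoint:
  assumes T: "T \<in> bounded_operators H" and S: "S \<in> carrier H \<rightarrow>\<^sub>E carrier H"
    and adj: "\<And>x y. x \<in> carrier H \<Longrightarrow> y \<in> carrier H \<Longrightarrow> hinner H (T x) y = hinner H x (S y)"
  shows "S \<in> bounded_operators H"
proof -
  note [simp] = bounded_operator_closed[OF T]
  obtain C where C: "\<And>x. x \<in> carrier H \<Longrightarrow> hnorm H (T x) \<le> C * hnorm H x"
    using bounded_operator_bound[OF T] by blast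
  have Sc [simp]: "S x \<in> carrier H" if "x \<in> carrier H" for x using S that by auto
  show ?thesis
  proof (rule bounded_operatorsI[OF S, of C])
    fix x y assume xy: "x \<in> carrier H" "y \<in> carrier H"
    show "S (x \<oplus> y) = S x \<oplus> S y"
      using xy by (intro hinner_right_eqI) (simp_all add: hinner_add_right flip: adj)
  next
    fix c x assume x: "x \<in> carrier H"
    show "S (c \<odot> x) = c \<odot> S x"
      using x by (intro hinner_right_eqI) (simp_all add: hinner_smult_right flip: adj)
  next
    fix x assume x: "x \<in> carrier H"
    have "(hnorm H (S x))\<^sup>2 = Re (hinner H (T (S x)) x)"
      using x Sc adj[of "S x" x] by (simp add: hnorm_sq)
    also have "\<dots> \<le> hnorm H (T (S x)) * hnorm H x"
      using Cauchy_Schwarz[of "T (S x)" x] complex_Re_le_cmod[of "hinner H (T (S x)) x"] x by simp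
    also have "\<dots> \<le> (C * hnorm H (S x)) * hnorm H x"
      using x Sc C by (intro mult_right_mono) (auto simp: hnorm_nonneg)
    finally have le: "hnorm H (S x) * hnorm H (S x) \<le> (C * hnorm H x) * hnorm H (S x)"
      by (simp add: power2_eq_square mult_ac)
    show "hnorm H (S x) \<le> C * hnorm H x"
    \<comment> \<open>Cancelling |S x| needs it nonzero. Otherwise 0 \<le> C |x| is read off from
      the bound on \<open>T x\<close>, as the sign of \<open>C\<close> is not fixed here.\<close>
    proof (cases "hnorm H (S x) = 0")
      case True
      then show ?thesis using C[OF x] hnorm_nonneg[of "T x"] x by simp
    next
      case False
      then show ?thesis using le hnorm_nonneg[OF Sc[OF x]] by (simp add: mult_le_cancel_right)
    qed
  qed
qed

section \<open>Adjoints\<close>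

lemma adjoint_operatorI:
  assumes S: "S \<in> bounded_operators H"
    and adj: "\<And>x y. x \<in> carrier H \<Longrightarrow> y \<in> carrier H \<Longrightarrow> hinner H (T x) y = hinner H x (S y)"
  shows "adjoint_operator H T = S"
  unfolding adjoint_operator_def
proof (rule the_equality)
  show "S \<in> bounded_operators H \<and>
      (\<forall>x\<in>carrier H. \<forall>y\<in>carrier H. hinner H (T x) y = hinner H x (S y))"
    using assms by blast
next
  fix R assume R: "R \<in> bounded_operators H \<and>
      (\<forall>x\<in>carrier H. \<forall>y\<in>carrier H. hinner H (T x) y = hinner H x (R y))"
  then have Rb: "R \<in> bounded_operators H" by blast
  have eq: "hinner H x (R y) = hinner H x (S y)" if "x \<in> carrier H" "y \<in> carrier H" for x y
    using R adj that by metis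
  show "R = S"
    by (rule bounded_operator_eqI[OF Rb S], rule hinner_right_eqI) (use Rb S eq in \<open>auto simp: bounded_operator_closed\<close>)
qed

text \<open>The value at \<open>y\<close> is the Riesz vector of the functional x -> <T x, y>;
  linearity and boundedness in \<open>y\<close> follow from the adjoint relation alone.\<close>

lemma adjoint_operator:
  assumes T: "T \<in> bounded_operators H"
  shows adjoint_operator_closed [simp]: "adjoint_operator H T \<in> bounded_operators H"
    and hinner_adjoint_right: "\<And>x y. x \<in> carrier H \<Longrightarrow> y \<in> carrier H \<Longrightarrow>
        hinner H x (adjoint_operator H T y) = hinner H (T x) y"
proof -
  note [simp] = bounded_operator_closed[OF T]
  obtain C where C: "C \<ge> 0" "\<And>x. x \<in> carrier H \<Longrightarrow> hnorm H (T x) \<le> C * hnorm H x"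
    using bounded_operator_bound[OF T] by blast
  have "\<exists>z\<in>carrier H. \<forall>x\<in>carrier H. hinner H (T x) y = hinner H x z" if y: "y \<in> carrier H" for y
  proof (rule Riesz_representation[of "\<lambda>x. hinner H (T x) y" "C * hnorm H y"])
    fix x assume x: "x \<in> carrier H"
    have "cmod (hinner H (T x) y) \<le> hnorm H (T x) * hnorm H y"
      using Cauchy_Schwarz x y by simp
    also have "\<dots> \<le> (C * hnorm H x) * hnorm H y"
      using C x y by (intro mult_right_mono) (auto simp: hnorm_nonneg)
    finally show "cmod (hinner H (T x) y) \<le> C * hnorm H y * hnorm H x" by (simp add: mult_ac)
  qed (use y in \<open>auto simp: bounded_operator_add[OF T] bounded_operator_smult[OF T] hinner_simps\<close>)
  then obtain S' where S': "\<And>y. y \<in> carrier H \<Longrightarrow> S' y \<in> carrier H"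
    "\<And>x y. x \<in> carrier H \<Longrightarrow> y \<in> carrier H \<Longrightarrow> hinner H (T x) y = hinner H x (S' y)"
    by metis
  define S where "S = restrict S' (carrier H)"
  have adj: "hinner H (T x) y = hinner H x (S y)" if "x \<in> carrier H" "y \<in> carrier H" for x y
    using S'(2) that by (simp add: S_def)
  have "S \<in> carrier H \<rightarrow>\<^sub>E carrier H" using S'(1) by (auto simp: S_def)
  then have S: "S \<in> bounded_operators H" by (rule bounded_operatorI_adjoint[OF T _ adj])
  have "adjoint_operator H T = S" using adjoint_operatorI[OF S adj] .
  with S adj show "adjoint_operator H T \<in> bounded_operators H"
    and "\<And>x y. x \<in> carrier H \<Longrightarrow> y \<in> carrier H \<Longrightarrow>
        hinner H x (adjoint_operator H T y) = hinner H (T x) y"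
    by auto
qed

lemma hinner_adjoint_left:
  assumes "T \<in> bounded_operators H" "x \<in> carrier H" "y \<in> carrier H"
  shows "hinner H (adjoint_operator H T x) y = hinner H x (T y)"
  using assms hinner_adjoint_right[of T y x] hinner_commute
  by (metis adjoint_operator_closed bounded_operator_closed)

section \<open>The algebra of bounded operators\<close>

lemma id_operator_bounded [simp]: "id_operator H \<in> bounded_operators H"
  by (rule bounded_operatorsI[of _ 1]) (auto simp: id_operator_def)

lemma zero_operator_bounded [simp]: "(\<lambda>x\<in>carrier H. \<zero>) \<in> bounded_operators H"
  by (rule bounded_operatorsI[of _ 0]) (auto simp: hnorm_def)

lemma rank_one_projection_bounded [simp]:
  assumes "\<xi> \<in> carrier H"
  shows "rank_one_projection H \<xi> \<in> bounded_operators H"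
proof (rule bounded_operatorsI)
  fix x assume x: "x \<in> carrier H"
  have "cmod (hinner H x \<xi>) * hnorm H \<xi> \<le> (hnorm H x * hnorm H \<xi>) * hnorm H \<xi>"
    using x assms Cauchy_Schwarz by (intro mult_right_mono) (auto simp: hnorm_nonneg)
  then show "hnorm H (rank_one_projection H \<xi> x) \<le> hnorm H \<xi> * hnorm H \<xi> * hnorm H x"
    using x assms by (simp add: rank_one_projection_def hnorm_smult mult_ac)
qed (use assms in \<open>auto simp: rank_one_projection_def hinner_simps complex_smult_distribs\<close>)

lemma compose_bounded [simp]:
  assumes S: "S \<in> bounded_operators H" and T: "T \<in> bounded_operators H"
  shows "compose (carrier H) S T \<in> bounded_operators H"
proof -
  note [simp] = S[THEN bounded_operator_closed] T[THEN bounded_operator_closed]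
  obtain C where C: "C \<ge> 0" "\<And>x. x \<in> carrier H \<Longrightarrow> hnorm H (S x) \<le> C * hnorm H x"
    using bounded_operator_bound[OF S] by blast
  obtain D where D: "\<And>x. x \<in> carrier H \<Longrightarrow> hnorm H (T x) \<le> D * hnorm H x"
    using bounded_operator_bound[OF T] by blast
  show ?thesis
  proof (rule bounded_operatorsI[of _ "C * D"])
    fix x assume x: "x \<in> carrier H"
    have "hnorm H (S (T x)) \<le> C * hnorm H (T x)" using C x by simp
    also have "\<dots> \<le> C * (D * hnorm H x)" using D x C(1) by (intro mult_left_mono) auto
    finally show "hnorm H (compose (carrier H) S T x) \<le> C * D * hnorm H x"
      using x by (simp add: compose_def mult_ac)
  qed (auto simp: compose_def S[THEN bounded_operator_add] S[THEN bounded_operator_smult]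
      T[THEN bounded_operator_add] T[THEN bounded_operator_smult])
qed

lemma add_operator_bounded [simp]:
  assumes S: "S \<in> bounded_operators H" and T: "T \<in> bounded_operators H"
  shows "(\<lambda>x\<in>carrier H. S x \<oplus> T x) \<in> bounded_operators H"
proof -
  note [simp] = S[THEN bounded_operator_closed] T[THEN bounded_operator_closed]
  obtain C where C: "\<And>x. x \<in> carrier H \<Longrightarrow> hnorm H (S x) \<le> C * hnorm H x"
    using bounded_operator_bound[OF S] by blast
  obtain D where D: "\<And>x. x \<in> carrier H \<Longrightarrow> hnorm H (T x) \<le> D * hnorm H x"
    using bounded_operator_bound[OF T] by blast
  show ?thesis
  proof (rule bounded_operatorsI[of _ "C + D"])
    fix x assume x: "x \<in> carrier H"
    show "hnorm H ((\<lambda>x\<in>carrier H. S x \<oplus> T x) x) \<le> (C + D) * hnorm H x"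
      using hnorm_triangle[of "S x" "T x"] C[OF x] D[OF x] x by (simp add: distrib_right)
  qed (auto simp: S[THEN bounded_operator_add] S[THEN bounded_operator_smult]
      T[THEN bounded_operator_add] T[THEN bounded_operator_smult] complex_smult_distribs M.a_ac)
qed

lemma smult_operator_bounded [simp]:
  assumes S: "S \<in> bounded_operators H"
  shows "(\<lambda>x\<in>carrier H. c \<odot> S x) \<in> bounded_operators H"
proof -
  note [simp] = S[THEN bounded_operator_closed]
  obtain C where C: "\<And>x. x \<in> carrier H \<Longrightarrow> hnorm H (S x) \<le> C * hnorm H x"
    using bounded_operator_bound[OF S] by blast
  show ?thesis
  proof (rule bounded_operatorsI[of _ "cmod c * C"])
    fix x assume x: "x \<in> carrier H"
    show "hnorm H ((\<lambda>x\<in>carrier H. c \<odot> S x) x) \<le> cmod c * C * hnorm H x"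
      using C[OF x] x by (simp add: hnorm_smult mult.assoc mult_left_mono)
  qed (auto simp: S[THEN bounded_operator_add] S[THEN bounded_operator_smult]
      complex_smult_distribs(2) mult.commute simp flip: complex_smult_distribs(3))
qed

lemma B_algebra_simps:
  "carrier (B_algebra H) = bounded_operators H"
  "monoid.mult (B_algebra H) = compose (carrier H)"
  "one (B_algebra H) = id_operator H"
  "zero (B_algebra H) = (\<lambda>x\<in>carrier H. \<zero>)"
  "add (B_algebra H) = (\<lambda>S T. \<lambda>x\<in>carrier H. S x \<oplus> T x)"
  "smult (B_algebra H) = (\<lambda>c T. \<lambda>x\<in>carrier H. c \<odot> T x)"
  "star (B_algebra H) = adjoint_operator H"
  by (simp_all add: B_algebra_def)

lemma B_algebra_abelian_group: "abelian_group (B_algebra H)"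
proof (rule abelian_groupI; unfold B_algebra_simps)
  fix S assume S: "S \<in> bounded_operators H"
  show "(\<lambda>x\<in>carrier H. (\<lambda>x\<in>carrier H. \<zero>) x \<oplus> S x) = S"
    by (rule restrict_eq_operatorI[OF S]) (use S in \<open>auto simp: bounded_operator_closed\<close>)
  show "\<exists>T\<in>bounded_operators H. (\<lambda>x\<in>carrier H. T x \<oplus> S x) = (\<lambda>x\<in>carrier H. \<zero>)"
  proof (rule bexI)
    show "(\<lambda>x\<in>carrier H. (\<lambda>x\<in>carrier H. (-1) \<odot> S x) x \<oplus> S x) = (\<lambda>x\<in>carrier H. \<zero>)"
      using S by (intro restrict_ext) (simp add: minus_one_smult M.l_neg bounded_operator_closed)
  qed (rule smult_operator_bounded[OF S])
qed (auto simp: M.a_ac bounded_operator_closed)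

lemma B_algebra_complex_algebra: "complex_algebra (B_algebra H)"
proof -
  have ring: "ring (B_algebra H)"
  proof (rule ringI)
    show "abelian_group (B_algebra H)" by (rule B_algebra_abelian_group)
    show "Group.monoid (B_algebra H)"
    proof (rule monoidI; unfold B_algebra_simps)
      fix S assume S: "S \<in> bounded_operators H"
      show "compose (carrier H) (id_operator H) S = S"
        unfolding compose_def by (rule restrict_eq_operatorI[OF S])
          (use S in \<open>auto simp: id_operator_def bounded_operator_closed\<close>)
      show "compose (carrier H) S (id_operator H) = S"
        unfolding compose_def by (rule restrict_eq_operatorI[OF S])
          (use S in \<open>auto simp: id_operator_def bounded_operator_closed\<close>)
    qed (simp_all, auto simp: compose_def bounded_operator_closed)
  qed (auto simp: B_algebra_simps compose_def bounded_operator_add bounded_operator_closed)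
  have "cring complex_ring" by (rule R.is_cring)
  then have "module complex_ring (B_algebra H)"
    by (rule moduleI[OF _ B_algebra_abelian_group])
      (auto simp: B_algebra_simps complex_smult_distribs bounded_operator_closed intro: restrict_eq_operatorI)
  with ring show ?thesis
    unfolding complex_algebra_def complex_algebra_axioms_def
    by (auto simp: B_algebra_simps compose_def bounded_operator_smult bounded_operator_closed)
qed

lemma vector_state_algebraic_probability_space:
  assumes "\<xi> \<in> carrier H" "hnorm H \<xi> = 1"
  shows "algebraic_probability_space (B_algebra H) (vector_state H \<xi>)"
  unfolding algebraic_probability_space_def algebraic_probability_space_axioms_def
  using assms B_algebra_complex_algebra
  by (auto simp: B_algebra_simps vector_state_def hinner_simps hinner_self id_operator_def bounded_operator_closed)

end


text \<open>With r = u 1 / u 0, repeated doubling forces u (2^k) \<ge> u 0 r^(2^k), so r > c would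
  outgrow M c^(2^k). What matters is that \<open>M\<close> is absent from the conclusion.\<close>

lemma le_of_square_le_doubling:
  fixes u :: "nat \<Rightarrow> real"
  assumes c: "c \<ge> 0" and u0: "u 0 \<ge> 0"
    and growth: "\<And>n. u n \<le> M * c ^ n"
    and doubling: "\<And>n. (u n)\<^sup>2 \<le> u 0 * u (2 * n)"
  shows "u 1 \<le> c * u 0"
proof (rule ccontr)
  assume less: "\<not> u 1 \<le> c * u 0"
  have "0 \<le> c * u 0" using c u0 by simp
  with less have u1: "u 1 > 0" by linarith
  \<comment> \<open>If \<open>u 0\<close> were zero, doubling at 1 would make \<open>u 1\<close>
    vanish; so the ratio below is meaningful.\<close>
  have pos: "u 0 > 0"
  proof (rule ccontr)
    assume "\<not> u 0 > 0"
    then have "u 0 = 0" using u0 by simp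
    then show False using doubling[of 1] u1 by simp
  qed
  define r where "r = u 1 / u 0"
  have r: "r > c" "r > 0" using less u1 pos by (simp_all add: r_def field_simps)
  have low: "u 0 * r ^ (2 ^ k) \<le> u (2 ^ k)" for k
  proof (induction k)
    case 0
    then show ?case using pos by (simp add: r_def)
  next
    case (Suc k)
    have "(u 0 * r ^ (2 ^ k))\<^sup>2 \<le> (u (2 ^ k))\<^sup>2"
      using Suc pos r by (intro power_mono) simp_all
    also have "\<dots> \<le> u 0 * u (2 ^ Suc k)" using doubling[of "2 ^ k"] by simp
    finally have "u 0 * (u 0 * r ^ (2 ^ Suc k)) \<le> u 0 * u (2 ^ Suc k)"
      by (simp add: power2_eq_square mult_2 power_add mult_ac)
    then show ?case using pos by simp
  qed
  have bound: "u 0 * r ^ (2 ^ k) \<le> M * c ^ (2 ^ k)" for k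
    using low growth order_trans by blast
  \<comment> \<open>For \<open>c\<close> zero the bound at exponent 1 is already contradictory, so
    division by \<open>c\<close> is allowed.\<close>
  have cpos: "c > 0"
  proof (rule ccontr)
    assume "\<not> c > 0"
    then have "c = 0" using c by simp
    then have "u 0 * r \<le> 0" using bound[of 0] by simp
    moreover have "u 0 * r > 0" using pos r by simp
    ultimately show False by simp
  qed
  then have "r / c > 1" using r by simp
  \<comment> \<open>The lower bound is known at powers of two only; an exponent \<open>n\<close>
    that suffices is therefore enlarged to 2^n.\<close>
  then obtain n where n: "M / u 0 < (r / c) ^ n" using real_arch_pow by blast
  also have "\<dots> \<le> (r / c) ^ (2 ^ n)"
    using \<open>r / c > 1\<close> by (intro power_increasing) (auto simp: less_imp_le)
  finally have "M * c ^ (2 ^ n) < u 0 * r ^ (2 ^ n)"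
    using pos cpos by (simp add: field_simps power_divide)
  with bound[of n] show False by simp
qed

context complex_hilbert_space
begin

lemma complex_submoduleI:
  assumes "S \<subseteq> carrier H" "\<zero> \<in> S"
    and "\<And>x y. x \<in> S \<Longrightarrow> y \<in> S \<Longrightarrow> x \<oplus> y \<in> S"
    and "\<And>c x. x \<in> S \<Longrightarrow> c \<odot> x \<in> S"
  shows "submodule S complex_ring H"
proof -
  have "\<ominus> x \<in> S" if "x \<in> S" for x
    using assms(1) assms(4)[OF that, of "-1"] that minus_one_smult[of x] by auto
  then show ?thesis
    using assms by (intro submoduleI) auto
qed

lemma carrier_submodule: "submodule (carrier H) complex_ring H"
  by (rule complex_submoduleI) auto

end

section \<open>Tensor products of operators\<close>

context hilbert_tensor_product
begin

sublocale K: complex_hilbert_space K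
  by (rule hilbert_tensor)

abbreviation product_vectors :: "('i \<Rightarrow> 'a) set" where
  "product_vectors \<equiv> \<Pi>\<^sub>E j\<in>J. carrier (H j)"

abbreviation coordinatewise :: "('i \<Rightarrow> 'a \<Rightarrow> 'a) \<Rightarrow> ('i \<Rightarrow> 'a) \<Rightarrow> 'i \<Rightarrow> 'a" where
  "coordinatewise A x \<equiv> \<lambda>j\<in>J. A j (x j)"

definition tensor_span :: "'b set" where
  "tensor_span = (\<lambda>S. submodule S complex_ring K) hull (tens ` product_vectors)"

lemma tens_carrier [simp]: "x \<in> product_vectors \<Longrightarrow> tens x \<in> carrier K"
  using tens_closed by auto

lemma product_vector_component: "x \<in> product_vectors \<Longrightarrow> j \<in> J \<Longrightarrow> x j \<in> carrier (H j)"
  by (rule PiE_mem)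

lemma restrict_product_vector [simp]: "x \<in> product_vectors \<Longrightarrow> restrict x J = x"
  by (simp add: PiE_iff extensional_restrict)

text \<open>Induction over the span: a property holds on it as soon as it cuts out a submodule
  containing the elementary tensors.\<close>

lemma tensor_span_minimal:
  assumes "submodule S complex_ring K" "\<And>x. x \<in> product_vectors \<Longrightarrow> tens x \<in> S"
  shows "tensor_span \<subseteq> S"
  unfolding tensor_span_def using assms by (intro hull_minimal) auto

lemma tensor_span_carrier: "s \<in> tensor_span \<Longrightarrow> s \<in> carrier K"
  using tensor_span_minimal[OF K.carrier_submodule] by auto

lemma tensor_span_dense:
  assumes "v \<in> carrier K" "e > 0"
  obtains s where "s \<in> tensor_span" "hnorm K (v \<ominus>\<^bsub>K\<^esub> s) < e"
proof -
  have "v \<in> {x \<in> carrier K. \<forall>r>0. \<exists>y\<in>tensor_span. y \<in> K.hilbert_metric.mball x r}"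
    using assms tens_total unfolding tensor_span_def K.hilbert_metric.metric_closure_of by simp
  then obtain s where "s \<in> tensor_span" "s \<in> K.hilbert_metric.mball v e" using assms by auto
  with that show thesis using tensor_span_carrier assms by (auto simp: hdist_def)
qed

text \<open>The difference \<open>z\<close> is orthogonal to the span, yet the span has a vector
  \<open>s\<close> closer to \<open>z\<close> than |z|; then |z|^2 = Re <z, z - s> < |z|^2. Vectors
  of \<open>K\<close> may therefore be specified by their inner products with elementary
  tensors.\<close>

lemma tens_separating:
  assumes v: "v \<in> carrier K" and w: "w \<in> carrier K"
    and eq: "\<And>x. x \<in> product_vectors \<Longrightarrow> hinner K v (tens x) = hinner K w (tens x)"
  shows "v = w"
proof (rule ccontr)
  assume "v \<noteq> w"
  define z where "z = v \<ominus>\<^bsub>K\<^esub> w"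
  have z: "z \<in> carrier K" and "z \<noteq> \<zero>\<^bsub>K\<^esub>"
    using v w \<open>v \<noteq> w\<close> by (simp_all add: z_def K.diff_eq_zero_iff)
  then have pos: "hnorm K z > 0" using K.hnorm_eq_0_iff K.hnorm_nonneg by fastforce
  obtain s where s: "s \<in> tensor_span" and near: "hnorm K (z \<ominus>\<^bsub>K\<^esub> s) < hnorm K z"
    using tensor_span_dense[OF z pos] .
  have "tensor_span \<subseteq> {s \<in> carrier K. hinner K z s = 0}"
    using z v w eq by (intro tensor_span_minimal K.complex_submoduleI)
      (auto simp: K.hinner_add_right K.hinner_smult_right K.hinner_diff_left z_def)
  then have sc: "s \<in> carrier K" and "hinner K z s = 0" using s by auto
  then have "(hnorm K z)\<^sup>2 = Re (hinner K z (z \<ominus>\<^bsub>K\<^esub> s))"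
    using z by (simp add: K.hnorm_sq K.hinner_diff_right)
  also have "\<dots> \<le> hnorm K z * hnorm K (z \<ominus>\<^bsub>K\<^esub> s)"
    using K.Cauchy_Schwarz[of z "z \<ominus>\<^bsub>K\<^esub> s"] complex_Re_le_cmod order_trans z sc by fastforce
  also have "\<dots> < hnorm K z * hnorm K z" using near pos by (intro mult_strict_left_mono)
  finally show False by (simp add: power2_eq_square)
qed

lemma hnorm_tens:
  assumes "x \<in> product_vectors"
  shows "hnorm K (tens x) = (\<Prod>j\<in>J. hnorm (H j) (x j))"
proof -
  have "hinner (H j) (x j) (x j) = of_real ((hnorm (H j) (x j))\<^sup>2)" if "j \<in> J" for j
    using assms that by (intro complex_hilbert_space.hinner_self hilbert_factor) auto
  then have "(hnorm K (tens x))\<^sup>2 = (\<Prod>j\<in>J. hnorm (H j) (x j))\<^sup>2"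
    using assms by (simp add: K.hnorm_sq hinner_tens prod_power_distrib flip: of_real_prod
      del: of_real_power)
  moreover have "(\<Prod>j\<in>J. hnorm (H j) (x j)) \<ge> 0"
    using assms by (intro prod_nonneg ballI complex_hilbert_space.hnorm_nonneg hilbert_factor) auto
  ultimately show ?thesis using assms K.hnorm_nonneg by simp
qed

end

text \<open>
  For bounded \<open>A\<^sub>j\<close> and \<open>S\<^sub>j = A\<^sub>j\<^sup>* A\<^sub>j\<close>, the relation \<open>tracked a w\<close> says that for some finite sum
  \<open>w 0 = \<Sum> c\<^sub>l \<Otimes>\<^sub>j x\<^sub>l\<^sub>j\<close> one has \<open>a = \<Sum> c\<^sub>l \<Otimes>\<^sub>j A\<^sub>j x\<^sub>l\<^sub>j\<close> and \<open>w n = \<Sum> c\<^sub>l \<Otimes>\<^sub>j S\<^sub>j\<^sup>n x\<^sub>l\<^sub>j\<close>.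
  The sequence \<open>u n = \<langle>w n, w 0\<rangle>\<close> grows at most geometrically and satisfies \<open>(u n)\<^sup>2 \<le> u 0 u (2n)\<close>,
  which bounds \<open>\<parallel>a\<parallel>\<^sup>2 = u 1\<close> by a multiple of \<open>\<parallel>w 0\<parallel>\<^sup>2 = u 0\<close>.
\<close>

locale tensor_product_operators = hilbert_tensor_product J H K tens
  for J :: "'i set" and H :: "'i \<Rightarrow> ('a, 'm) hilbert_scheme" and K :: "('b, 'n) hilbert_scheme"
    and tens :: "('i \<Rightarrow> 'a) \<Rightarrow> 'b" +
  fixes A :: "'i \<Rightarrow> 'a \<Rightarrow> 'a"
  assumes bounded: "\<And>j. j \<in> J \<Longrightarrow> A j \<in> bounded_operators (H j)"
begin

definition Adj :: "'i \<Rightarrow> 'a \<Rightarrow> 'a" where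
  "Adj j = adjoint_operator (H j) (A j)"

definition S :: "'i \<Rightarrow> 'a \<Rightarrow> 'a" where
  "S j u = Adj j (A j u)"

lemma A_closed: "j \<in> J \<Longrightarrow> u \<in> carrier (H j) \<Longrightarrow> A j u \<in> carrier (H j)"
  using complex_hilbert_space.bounded_operator_closed[OF hilbert_factor bounded] .

lemma Adj_bounded: "j \<in> J \<Longrightarrow> Adj j \<in> bounded_operators (H j)"
  unfolding Adj_def using complex_hilbert_space.adjoint_operator_closed[OF hilbert_factor bounded] .

lemma Adj_closed: "j \<in> J \<Longrightarrow> u \<in> carrier (H j) \<Longrightarrow> Adj j u \<in> carrier (H j)"
  using complex_hilbert_space.bounded_operator_closed[OF hilbert_factor Adj_bounded] .

lemma S_power_closed: "j \<in> J \<Longrightarrow> u \<in> carrier (H j) \<Longrightarrow> (S j ^^ n) u \<in> carrier (H j)"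
  by (induction n) (simp_all add: S_def A_closed Adj_closed)

lemma hinner_Adj_right:
  "j \<in> J \<Longrightarrow> u \<in> carrier (H j) \<Longrightarrow> v \<in> carrier (H j) \<Longrightarrow>
    hinner (H j) u (Adj j v) = hinner (H j) (A j u) v"
  unfolding Adj_def using complex_hilbert_space.hinner_adjoint_right[OF hilbert_factor bounded] .

lemma hinner_Adj_left:
  "j \<in> J \<Longrightarrow> u \<in> carrier (H j) \<Longrightarrow> v \<in> carrier (H j) \<Longrightarrow>
    hinner (H j) (Adj j u) v = hinner (H j) u (A j v)"
  unfolding Adj_def using complex_hilbert_space.hinner_adjoint_left[OF hilbert_factor bounded] .

text \<open>\<open>S j\<close> is formally self-adjoint, so its powers cross the inner product one
  factor at a time, each step raising \<open>n\<close>.\<close>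

lemma hinner_S_power:
  assumes j: "j \<in> J" and u: "u \<in> carrier (H j)" and v: "v \<in> carrier (H j)"
  shows "hinner (H j) ((S j ^^ n) u) ((S j ^^ m) v) = hinner (H j) ((S j ^^ (n + m)) u) v"
proof (induction m arbitrary: n)
  case (Suc m)
  have "hinner (H j) ((S j ^^ n) u) ((S j ^^ Suc m) v)
      = hinner (H j) ((S j ^^ Suc n) u) ((S j ^^ m) v)"
    using j u v by (simp add: S_def hinner_Adj_right hinner_Adj_left S_power_closed A_closed)
  then show ?case using Suc[of "Suc n"] by simp
qed simp

lemma coordinatewise_closeds:
  assumes "x \<in> product_vectors"
  shows "coordinatewise A x \<in> product_vectors" "coordinatewise Adj x \<in> product_vectors"
    "coordinatewise (\<lambda>j. S j ^^ n) x \<in> product_vectors"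
  using assms by (simp_all add: PiE_iff A_closed Adj_closed S_power_closed)

lemma tens_coordinatewise_closeds [simp]:
  assumes "x \<in> product_vectors"
  shows "tens (coordinatewise A x) \<in> carrier K" "tens (coordinatewise Adj x) \<in> carrier K"
    "tens (coordinatewise (\<lambda>j. S j ^^ n) x) \<in> carrier K"
  using coordinatewise_closeds[OF assms] tens_carrier by simp_all

text \<open>The families \<open>A\<close> and \<open>Adj\<close> are adjoint to each other on
  elementary tensors before any operator on \<open>K\<close> is available.\<close>

lemma hinner_tens_Adj:
  assumes x: "x \<in> product_vectors" and y: "y \<in> product_vectors"
  shows "hinner K (tens (coordinatewise A x)) (tens y) = hinner K (tens x) (tens (coordinatewise Adj y))"
    and "hinner K (tens (coordinatewise Adj x)) (tens y) = hinner K (tens x) (tens (coordinatewise A y))"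
  unfolding hinner_tens[OF coordinatewise_closeds(1)[OF x] y]
    hinner_tens[OF x coordinatewise_closeds(2)[OF y]]
    hinner_tens[OF coordinatewise_closeds(2)[OF x] y]
    hinner_tens[OF x coordinatewise_closeds(1)[OF y]]
  using x y by (auto intro!: prod.cong simp: hinner_Adj_right hinner_Adj_left product_vector_component)

section \<open>The norm estimate on the span of the elementary tensors\<close>

inductive tracked :: "'b \<Rightarrow> (nat \<Rightarrow> 'b) \<Rightarrow> bool" where
  tens: "x \<in> product_vectors \<Longrightarrow>
    tracked (tens (coordinatewise A x)) (\<lambda>n. tens (coordinatewise (\<lambda>j. S j ^^ n) x))"
| zero: "tracked \<zero>\<^bsub>K\<^esub> (\<lambda>n. \<zero>\<^bsub>K\<^esub>)"
| add: "tracked a w \<Longrightarrow> tracked b v \<Longrightarrow> tracked (a \<oplus>\<^bsub>K\<^esub> b) (\<lambda>n. w n \<oplus>\<^bsub>K\<^esub> v n)"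
| smult: "tracked a w \<Longrightarrow> tracked (c \<odot>\<^bsub>K\<^esub> a) (\<lambda>n. c \<odot>\<^bsub>K\<^esub> w n)"

lemma tracked_closed:
  assumes "tracked a w"
  shows "a \<in> carrier K" "w n \<in> carrier K"
  using assms by (induction) simp_all

text \<open>Lets the norm bound compare two approximants, whatever sums represent them.\<close>

lemma tracked_diff:
  assumes "tracked a w" "tracked b v"
  shows "tracked (a \<ominus>\<^bsub>K\<^esub> b) (\<lambda>n. w n \<ominus>\<^bsub>K\<^esub> v n)"
  using tracked.add[OF assms(1) tracked.smult[OF assms(2), of "-1"]] tracked_closed assms
  by (simp add: K.diff_conv_smult)

text \<open>All three identities are linear in the tracked pair, so only elementary tensors have to
  be checked, where inner products factor over \<open>J\<close>. The third is the weak formula that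
  later characterises the extended operator.\<close>

lemma tracked_tens:
  assumes "tracked a w" and y: "y \<in> product_vectors"
  shows "hinner K (w n) (tens (coordinatewise (\<lambda>j. S j ^^ m) y)) = hinner K (w (n + m)) (tens y)"
    and "hinner K a (tens (coordinatewise A y)) = hinner K (w 1) (tens y)"
    and "hinner K a (tens y) = hinner K (w 0) (tens (coordinatewise Adj y))"
  using assms(1)
proof (induction)
  case (tens x)
  note x = tens
  show "hinner K (tens (coordinatewise (\<lambda>j. S j ^^ n) x)) (tens (coordinatewise (\<lambda>j. S j ^^ m) y))
      = hinner K (tens (coordinatewise (\<lambda>j. S j ^^ (n + m)) x)) (tens y)"
    unfolding hinner_tens[OF coordinatewise_closeds(3)[OF x] coordinatewise_closeds(3)[OF y]]
      hinner_tens[OF coordinatewise_closeds(3)[OF x] y]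
    using x y by (auto intro!: prod.cong simp: hinner_S_power product_vector_component)
  show "hinner K (tens (coordinatewise A x)) (tens (coordinatewise A y))
      = hinner K (tens (coordinatewise (\<lambda>j. S j ^^ 1) x)) (tens y)"
    unfolding hinner_tens[OF coordinatewise_closeds(1)[OF x] coordinatewise_closeds(1)[OF y]]
      hinner_tens[OF coordinatewise_closeds(3)[OF x] y]
    using x y by (auto intro!: prod.cong simp: S_def hinner_Adj_left A_closed product_vector_component)
  have "coordinatewise (\<lambda>j. S j ^^ 0) x = x"
    using x by (auto simp: PiE_iff extensional_def)
  then show "hinner K (tens (coordinatewise A x)) (tens y)
      = hinner K (tens (coordinatewise (\<lambda>j. S j ^^ 0) x)) (tens (coordinatewise Adj y))"
    using hinner_tens_Adj(1)[OF x y] by simp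
qed (use y in \<open>simp_all add: K.hinner_add_left K.hinner_smult_left tracked_closed\<close>)

text \<open>A second induction, on the other pair; the two together expand a double sum of inner
  products without naming its terms. For coinciding pairs this gives |a|^2 = <w 1, w 0> and |w n|^2
  = <w (2n), w 0>.\<close>

lemma tracked_hinner:
  assumes t: "tracked a w" and "tracked b v"
  shows "hinner K (w n) (v m) = hinner K (w (n + m)) (v 0)"
    and "hinner K a b = hinner K (w 1) (v 0)"
  using assms(2)
proof (induction)
  case (tens x)
  show "hinner K (w n) (tens (coordinatewise (\<lambda>j. S j ^^ m) x))
      = hinner K (w (n + m)) (tens (coordinatewise (\<lambda>j. S j ^^ 0) x))"
    using tracked_tens(1)[OF t tens] tens by simp
  show "hinner K a (tens (coordinatewise A x)) = hinner K (w 1) (tens (coordinatewise (\<lambda>j. S j ^^ 0) x))"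
    using tracked_tens(2)[OF t tens] tens by simp
qed (simp_all add: K.hinner_add_right K.hinner_smult_right tracked_closed[OF t] tracked_closed)

lemma S_power_bound:
  obtains C where "\<And>j. j \<in> J \<Longrightarrow> 0 \<le> C j"
    "\<And>j u n. j \<in> J \<Longrightarrow> u \<in> carrier (H j) \<Longrightarrow> hnorm (H j) ((S j ^^ n) u) \<le> C j ^ n * hnorm (H j) u"
proof -
  have "\<exists>C\<ge>0. \<forall>u\<in>carrier (H j). \<forall>n. hnorm (H j) ((S j ^^ n) u) \<le> C ^ n * hnorm (H j) u"
    if j: "j \<in> J" for j
  proof -
    interpret Hj: complex_hilbert_space "H j" by (rule hilbert_factor[OF j])
    obtain C where C: "C \<ge> 0" "\<And>u. u \<in> carrier (H j) \<Longrightarrow> hnorm (H j) (A j u) \<le> C * hnorm (H j) u"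
      using Hj.bounded_operator_bound[OF bounded[OF j]] by metis
    obtain D where D: "D \<ge> 0" "\<And>u. u \<in> carrier (H j) \<Longrightarrow> hnorm (H j) (Adj j u) \<le> D * hnorm (H j) u"
      using Hj.bounded_operator_bound[OF Adj_bounded[OF j]] by metis
    have "hnorm (H j) ((S j ^^ n) u) \<le> (D * C) ^ n * hnorm (H j) u" if u: "u \<in> carrier (H j)" for u n
    proof (induction n)
      case (Suc n)
      have "hnorm (H j) ((S j ^^ Suc n) u) \<le> D * hnorm (H j) (A j ((S j ^^ n) u))"
        using D(2) j u by (simp add: S_def A_closed S_power_closed)
      also have "\<dots> \<le> D * (C * hnorm (H j) ((S j ^^ n) u))"
        using C(2) D(1) j u by (intro mult_left_mono) (simp_all add: S_power_closed)
      also have "\<dots> \<le> D * (C * ((D * C) ^ n * hnorm (H j) u))"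
        using Suc C(1) D(1) by (intro mult_left_mono) simp_all
      finally show ?case by (simp add: mult_ac)
    qed simp
    then show ?thesis using C(1) D(1) by (intro exI[of _ "D * C"]) simp
  qed
  then have "\<forall>j\<in>J. \<exists>C. C \<ge> 0 \<and> (\<forall>u\<in>carrier (H j). \<forall>n. hnorm (H j) ((S j ^^ n) u) \<le> C ^ n * hnorm (H j) u)"
    by blast
  then obtain C where "\<forall>j\<in>J. C j \<ge> 0 \<and>
      (\<forall>u\<in>carrier (H j). \<forall>n. hnorm (H j) ((S j ^^ n) u) \<le> C j ^ n * hnorm (H j) u)"
    unfolding bchoice_iff by blast
  then show thesis by (intro that[of C]) auto
qed

text \<open>The growth constant \<open>M\<close> depends on the chosen sum, while the base
  \<open>c\<close>, a product of bounds for the \<open>S j\<close>, does not.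
  \<open>le_of_square_le_doubling\<close> discards the former and leaves a uniform bound.\<close>

lemma tracked_bound:
  obtains c where "c \<ge> 0" "\<And>a w. tracked a w \<Longrightarrow> hnorm K a \<le> c * hnorm K (w 0)"
proof -
  obtain C where C: "\<And>j. j \<in> J \<Longrightarrow> 0 \<le> C j"
    "\<And>j u n. j \<in> J \<Longrightarrow> u \<in> carrier (H j) \<Longrightarrow> hnorm (H j) ((S j ^^ n) u) \<le> C j ^ n * hnorm (H j) u"
    using S_power_bound by blast
  define c where "c = (\<Prod>j\<in>J. C j)"
  have c: "c \<ge> 0" using C(1) by (simp add: c_def prod_nonneg)
  have growth: "\<exists>M. \<forall>n. hnorm K (w n) \<le> M * c ^ n" if "tracked a w" for a w
    using that
  proof induction
    case (tens x)
    have "hnorm K (tens (coordinatewise (\<lambda>j. S j ^^ n) x)) \<le> (\<Prod>j\<in>J. hnorm (H j) (x j)) * c ^ n" for n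
    proof -
      have "hnorm K (tens (coordinatewise (\<lambda>j. S j ^^ n) x)) = (\<Prod>j\<in>J. hnorm (H j) ((S j ^^ n) (x j)))"
        unfolding hnorm_tens[OF coordinatewise_closeds(3)[OF tens]] by simp
      also have "\<dots> \<le> (\<Prod>j\<in>J. C j ^ n * hnorm (H j) (x j))"
        using tens C(2) by (intro prod_mono conjI complex_hilbert_space.hnorm_nonneg
            hilbert_factor S_power_closed) (simp_all add: product_vector_component)
      finally show ?thesis by (simp add: prod.distrib c_def prod_power_distrib mult.commute)
    qed
    then show ?case by blast
  next
    case zero
    then show ?case by (intro exI[of _ 0]) (simp add: hnorm_def)
  next
    case (add a w b v)
    then obtain M M' where "\<And>n. hnorm K (w n) \<le> M * c ^ n" "\<And>n. hnorm K (v n) \<le> M' * c ^ n" by blast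
    then have "hnorm K (w n \<oplus>\<^bsub>K\<^esub> v n) \<le> (M + M') * c ^ n" for n
      using K.hnorm_triangle[of "w n" "v n"] tracked_closed add.hyps
      by (smt (verit, best) distrib_right)
    then show ?case by blast
  next
    case (smult a w d)
    then obtain M where M: "\<And>n. hnorm K (w n) \<le> M * c ^ n" by blast
    then have "hnorm K (d \<odot>\<^bsub>K\<^esub> w n) \<le> (cmod d * M) * c ^ n" for n
      using M[of n] tracked_closed[OF smult.hyps] by (simp add: K.hnorm_smult mult.assoc mult_left_mono)
    then show ?case by blast
  qed
  \<comment> \<open>The square root appears because \<open>u 1\<close> and \<open>u 0\<close> are
    the squares of the two norms.\<close>
  have "hnorm K a \<le> sqrt c * hnorm K (w 0)" if t: "tracked a w" for a w
  proof -
    note [simp] = tracked_closed[OF t]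
    obtain M where M: "\<And>n. hnorm K (w n) \<le> M * c ^ n" using growth[OF t] by blast
    define u where "u n = Re (hinner K (w n) (w 0))" for n
    have u0: "u 0 = (hnorm K (w 0))\<^sup>2" by (simp add: u_def K.hnorm_sq)
    have CS: "\<bar>u n\<bar> \<le> hnorm K (w n) * hnorm K (w 0)" for n
      using K.Cauchy_Schwarz[of "w n" "w 0"] abs_Re_le_cmod[of "hinner K (w n) (w 0)"]
      by (simp add: u_def)
    have "u 1 \<le> c * u 0"
    proof (rule le_of_square_le_doubling[where M = "M * hnorm K (w 0)"])
      fix n
      have "u n \<le> hnorm K (w n) * hnorm K (w 0)" using CS[of n] by simp
      also have "\<dots> \<le> (M * c ^ n) * hnorm K (w 0)"
        using M by (intro mult_right_mono) (simp_all add: K.hnorm_nonneg)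
      finally show "u n \<le> M * hnorm K (w 0) * c ^ n" by (simp add: mult_ac)
      \<comment> \<open>The doubling inequality is Cauchy-Schwarz, with |w n|^2 rewritten as u
        (2n).\<close>
      have "(u n)\<^sup>2 \<le> (hnorm K (w n) * hnorm K (w 0))\<^sup>2"
        using CS[of n] by (metis abs_ge_zero power2_abs power_mono)
      also have "\<dots> = u 0 * Re (hinner K (w n) (w n))"
        by (simp add: u0 power_mult_distrib mult.commute flip: K.hnorm_sq)
      also have "hinner K (w n) (w n) = hinner K (w (2 * n)) (w 0)"
        using tracked_hinner(1)[OF t t, of n n] by (simp add: mult_2)
      finally show "(u n)\<^sup>2 \<le> u 0 * u (2 * n)" by (simp add: u_def)
    qed (use c u0 in auto)
    then have "(hnorm K a)\<^sup>2 \<le> (sqrt c * hnorm K (w 0))\<^sup>2"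
      using c u0 tracked_hinner(2)[OF t t] by (simp add: u_def K.hnorm_sq power_mult_distrib)
    then show ?thesis
      using c by (rule_tac power2_le_imp_le) (simp_all add: K.hnorm_nonneg)
  qed
  with c that[of "sqrt c"] show thesis by simp
qed

section \<open>Extension from the span to the whole space\<close>

lemma tracked_exists:
  assumes "s \<in> tensor_span"
  obtains a w where "tracked a w" "w 0 = s"
proof -
  have "tensor_span \<subseteq> {s \<in> carrier K. \<exists>a w. tracked a w \<and> w 0 = s}"
  proof (rule tensor_span_minimal[OF K.complex_submoduleI])
    fix x assume x: "x \<in> product_vectors"
    have "coordinatewise (\<lambda>j. S j ^^ 0) x = x"
      using x by (auto simp: PiE_iff extensional_def)
    then show "tens x \<in> {s \<in> carrier K. \<exists>a w. tracked a w \<and> w 0 = s}"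
      using tracked.tens[OF x] x by fastforce
  qed (auto intro: tracked.intros)
  with assms that show thesis by blast
qed

text \<open>The vectors tracked along approximants of \<open>v\<close> form a Cauchy sequence by the
  bound on differences. Their limit \<open>b\<close> is pinned down by the weak formula, in which
  the approximants no longer occur.\<close>

lemma extension_exists:
  "\<exists>c. \<forall>v\<in>carrier K. \<exists>b\<in>carrier K. hnorm K b \<le> c * hnorm K v \<and>
     (\<forall>y\<in>product_vectors. hinner K b (tens y) = hinner K v (tens (coordinatewise Adj y)))"
proof -
  obtain c where c: "c \<ge> 0" "\<And>a w. tracked a w \<Longrightarrow> hnorm K a \<le> c * hnorm K (w 0)"
    using tracked_bound by blast
  have "\<exists>b\<in>carrier K. hnorm K b \<le> c * hnorm K v \<and>
     (\<forall>y\<in>product_vectors. hinner K b (tens y) = hinner K v (tens (coordinatewise Adj y)))"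
    if v: "v \<in> carrier K" for v
  proof -
    have "\<exists>a w. tracked a w \<and> hnorm K (v \<ominus>\<^bsub>K\<^esub> w 0) < inverse (real (Suc n))" for n
      using tensor_span_dense[OF v, of "inverse (real (Suc n))"] tracked_exists
      by (metis inverse_positive_iff_positive of_nat_0_less_iff zero_less_Suc)
    then obtain a w where t: "\<And>n. tracked (a n) (w n)"
      and near: "\<And>n. hnorm K (v \<ominus>\<^bsub>K\<^esub> w n 0) < inverse (real (Suc n))" by metis
    note [simp] = tracked_closed[OF t]
    have lim_w: "(\<lambda>n. hnorm K (w n 0 \<ominus>\<^bsub>K\<^esub> v)) \<longlonglongrightarrow> 0"
    proof (rule Lim_null_comparison[OF _ LIMSEQ_inverse_real_of_nat])
      show "\<forall>\<^sub>F n in sequentially. norm (hnorm K (w n 0 \<ominus>\<^bsub>K\<^esub> v)) \<le> inverse (real (Suc n))"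
        using near v K.hnorm_diff_commute[of _ v] by (simp add: K.hnorm_nonneg less_imp_le)
    qed
    have C: "\<exists>N. \<forall>m\<ge>N. \<forall>n\<ge>N. hnorm K (a m \<ominus>\<^bsub>K\<^esub> a n) < e" if e: "e > 0" for e
    proof -
      \<comment> \<open>Two distances to \<open>v\<close> are added and the sum is multiplied by
        \<open>c\<close>; \<open>c + 1\<close> stands in for \<open>c\<close>, which may be zero, as
        divisor.\<close>
      have "0 < e / (2 * (c + 1))" using e c by simp
      then obtain N where N: "inverse (real (Suc N)) < e / (2 * (c + 1))"
        using reals_Archimedean by blast
      have "hnorm K (a m \<ominus>\<^bsub>K\<^esub> a n) < e" if "m \<ge> N" "n \<ge> N" for m n
      proof -
        have close: "hnorm K (v \<ominus>\<^bsub>K\<^esub> w k 0) < e / (2 * (c + 1))" if "k \<ge> N" for k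
        proof -
          have "inverse (real (Suc k)) \<le> inverse (real (Suc N))"
            using that by (auto intro: le_imp_inverse_le)
          with near[of k] N show ?thesis by (meson less_le_trans less_trans)
        qed
        have "hnorm K (w m 0 \<ominus>\<^bsub>K\<^esub> v) < e / (2 * (c + 1))"
          using close[OF that(1)] v K.hnorm_diff_commute[of v "w m 0"] by simp
        with close[OF that(2)]
        have "hnorm K (w m 0 \<ominus>\<^bsub>K\<^esub> w n 0) \<le> e / (2 * (c + 1)) + e / (2 * (c + 1))"
          using K.hnorm_diff_triangle[of "w m 0" v "w n 0"] v by simp
        also have "e / (2 * k) + e / (2 * k) = e / k" for k :: real
          by (cases "k = 0") (simp_all add: field_simps)
        finally have "hnorm K (w m 0 \<ominus>\<^bsub>K\<^esub> w n 0) \<le> e / (c + 1)" .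
        then have "c * hnorm K (w m 0 \<ominus>\<^bsub>K\<^esub> w n 0) \<le> c * (e / (c + 1))"
          using c(1) by (rule mult_left_mono)
        also have "\<dots> < e" using c(1) e by (simp add: field_simps)
        finally show ?thesis using c(2)[OF tracked_diff[OF t t], of m n] by simp
      qed
      then show ?thesis by blast
    qed
    obtain b where b: "b \<in> carrier K" and lim: "(\<lambda>n. hnorm K (a n \<ominus>\<^bsub>K\<^esub> b)) \<longlonglongrightarrow> 0"
      by (rule K.Cauchy_sequence_limit[of a, OF _ C]) simp_all
    have "hnorm K b \<le> c * hnorm K v"
    proof (rule LIMSEQ_le)
      show "(\<lambda>n. hnorm K (a n)) \<longlonglongrightarrow> hnorm K b"
        by (rule K.hnorm_tendsto[OF _ b lim]) simp
      show "(\<lambda>n. c * hnorm K (w n 0)) \<longlonglongrightarrow> c * hnorm K v"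
        by (intro tendsto_mult tendsto_const K.hnorm_tendsto[OF _ v lim_w]) simp
      show "\<exists>N. \<forall>n\<ge>N. hnorm K (a n) \<le> c * hnorm K (w n 0)" using c(2)[OF t] by blast
    qed
    moreover have "hinner K b (tens y) = hinner K v (tens (coordinatewise Adj y))"
      if y: "y \<in> product_vectors" for y
    proof (rule LIMSEQ_unique)
      show "(\<lambda>n. hinner K (a n) (tens y)) \<longlonglongrightarrow> hinner K b (tens y)"
        by (rule K.hinner_tendsto[OF _ b _ lim]) (simp_all add: y)
      show "(\<lambda>n. hinner K (a n) (tens y)) \<longlonglongrightarrow> hinner K v (tens (coordinatewise Adj y))"
        unfolding tracked_tens(3)[OF t y]
        by (rule K.hinner_tendsto[OF _ v _ lim_w]) (simp_all add: y)
    qed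
    ultimately show ?thesis using b by blast
  qed
  then show ?thesis by blast
qed

text \<open>A value is picked for each \<open>v\<close> separately. Linearity is still automatic, as
  the weak formula is linear in \<open>v\<close> and determines the value.\<close>

lemma tensor_operator_exists:
  obtains T where "T \<in> bounded_operators K"
    "\<And>x. x \<in> product_vectors \<Longrightarrow> T (tens x) = tens (coordinatewise A x)"
proof -
  obtain c where "\<forall>v\<in>carrier K. \<exists>b\<in>carrier K. hnorm K b \<le> c * hnorm K v \<and>
     (\<forall>y\<in>product_vectors. hinner K b (tens y) = hinner K v (tens (coordinatewise Adj y)))"
    using extension_exists by (rule exE)
  from bchoice[OF this[unfolded Bex_def]]
  obtain T' where T'_ext: "\<forall>v\<in>carrier K. T' v \<in> carrier K \<and> hnorm K (T' v) \<le> c * hnorm K v \<and>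
     (\<forall>y\<in>product_vectors. hinner K (T' v) (tens y) = hinner K v (tens (coordinatewise Adj y)))"
    by (rule exE)
  have T': "T' v \<in> carrier K" "hnorm K (T' v) \<le> c * hnorm K v"
    "\<And>y. y \<in> product_vectors \<Longrightarrow>
      hinner K (T' v) (tens y) = hinner K v (tens (coordinatewise Adj y))"
    if "v \<in> carrier K" for v
    using T'_ext that by auto
  define T where "T = restrict T' (carrier K)"
  have T: "T v \<in> carrier K" "hnorm K (T v) \<le> c * hnorm K v" if "v \<in> carrier K" for v
    using that T' by (simp_all add: T_def)
  have adj: "hinner K (T v) (tens y) = hinner K v (tens (coordinatewise Adj y))"
    if "v \<in> carrier K" "y \<in> product_vectors" for v y
    using that T' by (simp add: T_def)
  have "T \<in> bounded_operators K"
  proof (rule K.bounded_operatorsI[of _ c])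
    show "T \<in> carrier K \<rightarrow>\<^sub>E carrier K" using T'(1) by (auto simp: T_def)
  next
    fix v w assume "v \<in> carrier K" "w \<in> carrier K"
    then show "T (v \<oplus>\<^bsub>K\<^esub> w) = T v \<oplus>\<^bsub>K\<^esub> T w"
      by (intro tens_separating) (simp_all add: T(1) K.hinner_add_left adj)
  next
    fix c v assume "v \<in> carrier K"
    then show "T (c \<odot>\<^bsub>K\<^esub> v) = c \<odot>\<^bsub>K\<^esub> T v"
      by (intro tens_separating) (simp_all add: T(1) K.hinner_smult_left adj)
  qed (rule T(2))
  moreover have "T (tens x) = tens (coordinatewise A x)" if x: "x \<in> product_vectors" for x
  proof (rule tens_separating)
    fix y assume y: "y \<in> product_vectors"
    show "hinner K (T (tens x)) (tens y) = hinner K (tens (coordinatewise A x)) (tens y)"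
      using x y adj hinner_tens_Adj(1) by simp
  qed (use x in \<open>simp_all add: T(1)\<close>)
  ultimately show thesis by (rule that)
qed

end

section \<open>Uniqueness and adjoints of tensor operators\<close>

context hilbert_tensor_product
begin

text \<open>Testing the adjoints of \<open>T\<close> and \<open>T'\<close> against elementary
  tensors involves only values that agree, so the adjoints agree everywhere, and hence so do
  \<open>T\<close> and \<open>T'\<close>. This replaces a continuity argument on the dense
  span.\<close>

lemma bounded_operator_eqI_tens:
  assumes T: "T \<in> bounded_operators K" and T': "T' \<in> bounded_operators K"
    and eq: "\<And>x. x \<in> product_vectors \<Longrightarrow> T (tens x) = T' (tens x)"
  shows "T = T'"
proof (rule K.bounded_operator_eqI[OF T T'])
  note [simp] = K.bounded_operator_closed[OF T] K.bounded_operator_closed[OF T']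
    K.bounded_operator_closed[OF K.adjoint_operator_closed[OF T]]
    K.bounded_operator_closed[OF K.adjoint_operator_closed[OF T']]
  have adj: "adjoint_operator K T y = adjoint_operator K T' y" if y: "y \<in> carrier K" for y
    using y eq by (intro tens_separating)
      (simp_all add: K.hinner_adjoint_left[OF T] K.hinner_adjoint_left[OF T'])
  fix v assume v: "v \<in> carrier K"
  show "T v = T' v"
  proof (rule K.hinner_left_eqI)
    fix y assume "y \<in> carrier K"
    then show "hinner K (T v) y = hinner K (T' v) y"
      using adj[of y] v K.hinner_adjoint_right[OF T, of v y] K.hinner_adjoint_right[OF T', of v y]
      by simp
  qed (use v in simp_all)
qed

lemma tensor_operator_eqI:
  assumes "T \<in> bounded_operators K"
    and "\<And>x. x \<in> product_vectors \<Longrightarrow> T (tens x) = tens (coordinatewise A x)"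
  shows "tensor_operator J H K tens A = T"
  unfolding tensor_operator_def
proof (rule the_equality)
  fix R assume "R \<in> bounded_operators K \<and>
    (\<forall>x\<in>product_vectors. R (tens x) = tens (coordinatewise A x))"
  then show "R = T"
    using assms by (intro bounded_operator_eqI_tens) simp_all
qed (use assms in simp)

lemma tensor_operator:
  assumes "\<And>j. j \<in> J \<Longrightarrow> A j \<in> bounded_operators (H j)"
  shows tensor_operator_bounded: "tensor_operator J H K tens A \<in> bounded_operators K"
    and tensor_operator_tens: "\<And>x. x \<in> product_vectors \<Longrightarrow>
      tensor_operator J H K tens A (tens x) = tens (coordinatewise A x)"
proof -
  interpret tensor_product_operators J H K tens A
    by unfold_locales (rule assms)
  obtain T where "T \<in> bounded_operators K"
    "\<And>x. x \<in> product_vectors \<Longrightarrow> T (tens x) = tens (coordinatewise A x)"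
    using tensor_operator_exists by blast
  with tensor_operator_eqI[of T A]
  show "tensor_operator J H K tens A \<in> bounded_operators K"
    and "\<And>x. x \<in> product_vectors \<Longrightarrow>
      tensor_operator J H K tens A (tens x) = tens (coordinatewise A x)"
    by simp_all
qed

lemma adjoint_tensor_operator:
  assumes A: "\<And>j. j \<in> J \<Longrightarrow> A j \<in> bounded_operators (H j)"
  shows "adjoint_operator K (tensor_operator J H K tens A)
    = tensor_operator J H K tens (\<lambda>j. adjoint_operator (H j) (A j))"
proof (rule tensor_operator_eqI[symmetric])
  interpret tensor_product_operators J H K tens A
    by unfold_locales (rule A)
  let ?T = "tensor_operator J H K tens A"
  have T: "?T \<in> bounded_operators K" by (rule tensor_operator_bounded[OF A])
  show T': "adjoint_operator K ?T \<in> bounded_operators K"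
    by (rule K.adjoint_operator_closed[OF T])
  fix y assume y: "y \<in> product_vectors"
  have "adjoint_operator K ?T (tens y) = tens (coordinatewise Adj y)"
  proof (rule tens_separating)
    fix x assume x: "x \<in> product_vectors"
    show "hinner K (adjoint_operator K ?T (tens y)) (tens x)
        = hinner K (tens (coordinatewise Adj y)) (tens x)"
      using x y by (simp add: K.hinner_adjoint_left[OF T] tensor_operator_tens[OF A] hinner_tens_Adj(2))
  qed (use y K.bounded_operator_closed[OF T'] in simp_all)
  then show "adjoint_operator K ?T (tens y) = tens (coordinatewise (\<lambda>j. adjoint_operator (H j) (A j)) y)"
    by (simp add: Adj_def)
qed

end


section \<open>Words of operators\<close>

text \<open>\<open>star_hom\<close> speaks of sums, scalars, products and stars; zero and negatives
  in the image come from scaling by 0 and -1.\<close>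

lemma star_hom_image_star_subalgebra:
  assumes A: "complex_algebra A" and B: "complex_algebra B" and f: "f \<in> star_hom A B"
    and star: "\<And>x. x \<in> carrier A \<Longrightarrow> star A x \<in> carrier A"
  shows "star_subalgebra (f ` carrier A) B"
proof -
  interpret A: complex_algebra A by (rule A)
  have A_closed: "x \<oplus>\<^bsub>A\<^esub> y \<in> carrier A" "x \<otimes>\<^bsub>A\<^esub> y \<in> carrier A"
    if "x \<in> carrier A" "y \<in> carrier A" for x y
    using that ring.ring_simprules(1,5)[OF complex_algebra.axioms(1)[OF A]] by auto
  interpret B: complex_algebra B by (rule B)
  have closed: "f x \<in> carrier B" if "x \<in> carrier A" for x
    using f that by (auto simp: star_hom_def)
  have hom: "f (x \<oplus>\<^bsub>A\<^esub> y) = f x \<oplus>\<^bsub>B\<^esub> f y" "f (c \<odot>\<^bsub>A\<^esub> x) = c \<odot>\<^bsub>B\<^esub> f x"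
    "f (x \<otimes>\<^bsub>A\<^esub> y) = f x \<otimes>\<^bsub>B\<^esub> f y" "f (star A x) = star B (f x)"
    if "x \<in> carrier A" "y \<in> carrier A" for x y c
    using f that by (auto simp: star_hom_def)
  have smult: "c \<odot>\<^bsub>B\<^esub> y \<in> f ` carrier A" if "y \<in> f ` carrier A" for c y
  proof -
    from that obtain x where x: "x \<in> carrier A" "y = f x" by blast
    have "c \<odot>\<^bsub>A\<^esub> x \<in> carrier A" using A.smult_closed[of c x] x by simp
    then show ?thesis using hom(2)[OF x(1) x(1), of c] x(2) by (auto intro: rev_image_eqI)
  qed
  have "submodule (f ` carrier A) complex_ring B"
  proof (rule B.submoduleI)
    show "f ` carrier A \<subseteq> carrier B" using closed by blast
    have "\<zero>\<^bsub>B\<^esub> = 0 \<odot>\<^bsub>B\<^esub> f \<zero>\<^bsub>A\<^esub>"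
      using B.smult_l_null[of "f \<zero>\<^bsub>A\<^esub>"] closed by simp
    then show "\<zero>\<^bsub>B\<^esub> \<in> f ` carrier A" using smult[of "f \<zero>\<^bsub>A\<^esub>" 0] by simp
    fix y assume y: "y \<in> f ` carrier A"
    then have "y \<in> carrier B" using closed by blast
    then have "\<ominus>\<^bsub>B\<^esub> y = (-1) \<odot>\<^bsub>B\<^esub> y"
      using B.smult_l_minus[of 1 y] B.smult_one[of y] by simp
    then show "\<ominus>\<^bsub>B\<^esub> y \<in> f ` carrier A" using smult[OF y] by simp
  next
    fix y z assume "y \<in> f ` carrier A" "z \<in> f ` carrier A"
    then show "y \<oplus>\<^bsub>B\<^esub> z \<in> f ` carrier A"
      by (elim imageE) (simp add: hom(1)[symmetric] A_closed)
  qed (rule smult)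
  moreover have "y \<otimes>\<^bsub>B\<^esub> z \<in> f ` carrier A" "star B y \<in> f ` carrier A"
    if "y \<in> f ` carrier A" "z \<in> f ` carrier A" for y z
    using that by (elim imageE; simp add: hom(3,4)[symmetric] A_closed star)+
  ultimately show ?thesis
    unfolding star_subalgebra_def nonunital_subalgebra_def by blast
qed

section \<open>Words cut by projections\<close>

lemma sorted_list_of_set_insert_greater:
  fixes n :: nat
  assumes "finite B" "\<And>k. k \<in> B \<Longrightarrow> k < n"
  shows "sorted_list_of_set (insert n B) = sorted_list_of_set B @ [n]"
proof -
  let ?xs = "sorted_list_of_set B @ [n]"
  have "sorted_list_of_set (set ?xs) = ?xs"
    using assms by (intro sorted_list_of_set.idem_if_sorted_distinct)
      (auto simp: sorted_append less_imp_le)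
  then show ?thesis using assms by simp
qed

text \<open>The index of the segment containing position \<open>k\<close>. The count is strict, so a
  cut still has the index of the segment that it closes.\<close>

definition cuts_before :: "nat set \<Rightarrow> nat \<Rightarrow> nat" where
  "cuts_before cuts k = card ({1..<k} \<inter> cuts)"

text \<open>Empty blocks are allowed, so that \<open>t\<close> can range over a set independent of
  the cuts.\<close>

definition cut_block :: "nat set \<Rightarrow> nat set \<Rightarrow> nat \<Rightarrow> nat \<Rightarrow> nat set" where
  "cut_block col cuts n t = {k \<in> {1..n} \<inter> col. cuts_before cuts k = t}"

lemma cuts_before_mono: "k \<le> l \<Longrightarrow> cuts_before cuts k \<le> cuts_before cuts l"
  unfolding cuts_before_def by (intro card_mono) auto

lemma finite_cut_block [simp]: "finite (cut_block col cuts n t)"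
  by (simp add: cut_block_def)

context complex_hilbert_space
begin

lemma foldr_operators_closed:
  assumes "\<And>k. k \<in> set ks \<Longrightarrow> T k \<in> bounded_operators H" "x \<in> carrier H"
  shows "foldr T ks x \<in> carrier H"
  using assms by (induction ks) (auto intro: bounded_operator_closed)

lemma foldr_operators_smult:
  assumes "\<And>k. k \<in> set ks \<Longrightarrow> T k \<in> bounded_operators H" "x \<in> carrier H"
  shows "foldr T ks (c \<odot> x) = c \<odot> foldr T ks x"
  using assms by (induction ks) (auto simp: bounded_operator_smult foldr_operators_closed)

lemma foldr_operators_fixed:
  assumes "\<And>k. k \<in> set ks \<Longrightarrow> T k x = x"
  shows "foldr T ks x = x"
  using assms by (induction ks) auto

text \<open>
  A projection in a word sends \<open>x\<close> to \<open>\<langle>x, e\<rangle> e\<close>, so the expectation of the word splits there.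
\<close>

context
  fixes T :: "nat \<Rightarrow> 'a \<Rightarrow> 'a" and e :: 'a and col cuts :: "nat set" and m :: nat
  assumes e: "e \<in> carrier H" "hnorm H e = 1"
    and disjoint: "col \<inter> cuts = {}"
    and T: "\<And>k. k \<in> {1..m} \<Longrightarrow> T k \<in> bounded_operators H"
    and T_cut: "\<And>k. k \<in> {1..m} \<Longrightarrow> k \<in> cuts \<Longrightarrow> T k = rank_one_projection H e"
    and T_id: "\<And>k. k \<in> {1..m} \<Longrightarrow> k \<notin> cuts \<Longrightarrow> k \<notin> col \<Longrightarrow> T k = id_operator H"
begin

abbreviation (input) word :: "nat set \<Rightarrow> 'a \<Rightarrow> 'a" where
  "word B \<equiv> foldr T (sorted_list_of_set B)"

lemma word_block_closed: "n \<le> m \<Longrightarrow> x \<in> carrier H \<Longrightarrow> word (cut_block col cuts n t) x \<in> carrier H"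
  by (rule foldr_operators_closed) (auto simp: cut_block_def intro: T)

text \<open>The vector on the right is arbitrary so that the last letter, which acts first, can be
  absorbed into it. Segments closed by a cut see only \<open>e\<close>; the last, open one sees
  \<open>x\<close>.\<close>

lemma hinner_word_atMost:
  assumes "n \<le> m" "x \<in> carrier H"
  shows "hinner H (word {1..n} x) e =
    (\<Prod>t<cuts_before cuts (Suc n). hinner H (word (cut_block col cuts n t) e) e) *
    hinner H (word (cut_block col cuts n (cuts_before cuts (Suc n))) x) e"
  using assms
proof (induction n arbitrary: x)
  case 0
  then show ?case by (simp add: cut_block_def cuts_before_def)
next
  case (Suc n)
  note x = \<open>x \<in> carrier H\<close>
  define c where "c = cuts_before cuts (Suc n)"
  have k: "Suc n \<in> {1..m}" using Suc.prems by simp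
  have atMost: "{1..Suc n} = insert (Suc n) {1..n}" by auto
  have "word {1..Suc n} x = word {1..n} (T (Suc n) x)"
    unfolding atMost by (subst sorted_list_of_set_insert_greater) auto
  also have "hinner H \<dots> e =
      (\<Prod>t<c. hinner H (word (cut_block col cuts n t) e) e) * hinner H (word (cut_block col cuts n c) (T (Suc n) x)) e"
    unfolding c_def using Suc.prems T[OF k] by (intro Suc.IH) (simp_all add: bounded_operator_closed)
  finally have step: "hinner H (word {1..Suc n} x) e =
      (\<Prod>t<c. hinner H (word (cut_block col cuts n t) e) e) * hinner H (word (cut_block col cuts n c) (T (Suc n) x)) e" .
  have before: "{1..<Suc (Suc n)} = insert (Suc n) {1..<Suc n}" by auto
  consider "Suc n \<in> col" "Suc n \<notin> cuts" | "Suc n \<in> cuts" "Suc n \<notin> col" | "Suc n \<notin> col" "Suc n \<notin> cuts"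
    using disjoint by blast
  then show ?case
  proof cases
    case 1
    then have c': "cuts_before cuts (Suc (Suc n)) = c"
      unfolding c_def cuts_before_def before by simp
    have "cut_block col cuts (Suc n) t = cut_block col cuts n t" if "t < c" for t
      using that by (auto simp: cut_block_def c_def le_Suc_eq)
    moreover have insert: "cut_block col cuts (Suc n) c = insert (Suc n) (cut_block col cuts n c)"
      using 1 by (auto simp: cut_block_def c_def le_Suc_eq)
    have "word (cut_block col cuts (Suc n) c) x = word (cut_block col cuts n c) (T (Suc n) x)"
      unfolding insert by (subst sorted_list_of_set_insert_greater) (auto simp: cut_block_def)
    ultimately show ?thesis using step by (simp add: c')
  next
    case 2
    have c': "cuts_before cuts (Suc (Suc n)) = Suc c"
      using 2 unfolding c_def cuts_before_def before by simp
    have blocks: "cut_block col cuts (Suc n) t = cut_block col cuts n t" for t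
      using 2 by (auto simp: cut_block_def le_Suc_eq)
    have "cuts_before cuts l \<le> c" if "l \<in> {1..n}" for l
      using that by (auto simp: c_def intro!: cuts_before_mono)
    then have empty: "cut_block col cuts n (Suc c) = {}"
      by (fastforce simp: cut_block_def)
    \<comment> \<open>The cut closes segment \<open>c\<close> with \<open>e\<close> at its right end
      and releases the scalar <x, e>, which is the factor of the new, still empty segment.\<close>
    have "T (Suc n) x = hinner H x e \<odot> e"
      using T_cut[OF k 2(1)] x by (simp add: rank_one_projection_def)
    then have "word (cut_block col cuts n c) (T (Suc n) x) = hinner H x e \<odot> word (cut_block col cuts n c) e"
      using Suc.prems e by (simp only:) (rule foldr_operators_smult, auto simp: cut_block_def intro!: T)
    then show ?thesis
      using step Suc.prems e x word_block_closed[of n e c]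
      by (simp add: c' blocks empty hinner_smult_left mult_ac)
  next
    case 3
    then have c': "cuts_before cuts (Suc (Suc n)) = c"
      unfolding c_def cuts_before_def before by simp
    have blocks: "cut_block col cuts (Suc n) t = cut_block col cuts n t" for t
      using 3 by (auto simp: cut_block_def le_Suc_eq)
    show ?thesis
      using step T_id[OF k 3(2,1)] x by (simp add: c' blocks id_operator_def)
  qed
qed

text \<open>At x = e the open segment looks like the closed ones. The range is padded to all t \<le>
  m, the same for every colour; the surplus blocks are empty and contribute <e, e> = 1.\<close>

lemma hinner_word_eq_prod_blocks:
  "hinner H (word {1..m} e) e = (\<Prod>t\<le>m. hinner H (word (cut_block col cuts m t) e) e)"
proof -
  define c where "c = cuts_before cuts (Suc m)"
  have "card ({1..<Suc m} \<inter> cuts) \<le> card {1..<Suc m}" by (intro card_mono) auto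
  then have c: "c \<le> m" by (simp add: c_def cuts_before_def)
  have "cuts_before cuts l \<le> c" if "l \<in> {1..m}" for l
    using that by (auto simp: c_def intro!: cuts_before_mono)
  then have "cut_block col cuts m t = {}" if "t > c" for t
    using that by (fastforce simp: cut_block_def)
  then have empty: "hinner H (word (cut_block col cuts m t) e) e = 1" if "t > c" for t
    using that e by (simp add: hinner_self)
  have "hinner H (word {1..m} e) e = (\<Prod>t<Suc c. hinner H (word (cut_block col cuts m t) e) e)"
    using hinner_word_atMost[OF order_refl e(1)] by (simp add: c_def)
  also have "\<dots> = (\<Prod>t\<le>m. hinner H (word (cut_block col cuts m t) e) e)"
    by (rule prod.mono_neutral_left) (use c empty in auto)
  finally show ?thesis .
qed

end

end

section \<open>The kernel partition as a family of cut blocks\<close>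

lemma cuts_before_eq_iff:
  assumes "k \<le> k'" "k \<ge> 1" "k \<notin> cuts"
  shows "cuts_before cuts k = cuts_before cuts k' \<longleftrightarrow> (\<forall>l. k < l \<and> l < k' \<longrightarrow> l \<notin> cuts)"
proof
  assume eq: "cuts_before cuts k = cuts_before cuts k'"
  have same: "{1..<k} \<inter> cuts = {1..<k'} \<inter> cuts"
    using assms eq by (intro card_subset_eq) (auto simp: cuts_before_def)
  show "\<forall>l. k < l \<and> l < k' \<longrightarrow> l \<notin> cuts"
  proof (intro allI impI notI)
    fix l assume l: "k < l \<and> l < k'" "l \<in> cuts"
    then have "l \<in> {1..<k'} \<inter> cuts" using assms by simp
    then have "l \<in> {1..<k} \<inter> cuts" unfolding same .
    with l show False by simp
  qed
next
  assume none: "\<forall>l. k < l \<and> l < k' \<longrightarrow> l \<notin> cuts"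
  \<comment> \<open>Since \<open>k\<close> is not a cut, a cut before \<open>k'\<close> that does
    not lie strictly between must precede \<open>k\<close>.\<close>
  have "l < k" if "l < k'" "l \<in> cuts" for l
    using that none assms(3) by (metis linorder_neqE_nat)
  then have "{1..<k} \<inter> cuts = {1..<k'} \<inter> cuts"
    using assms(1) by auto
  then show "cuts_before cuts k = cuts_before cuts k'" by (simp add: cuts_before_def)
qed

text \<open>The positions whose operator acts in tensor factor \<open>j\<close> by the projection
  onto the line of \<open>\<xi> j\<close>.\<close>

definition color_cuts :: "'i pair_pre_digraph \<Rightarrow> (nat \<Rightarrow> 'i) \<Rightarrow> 'i \<Rightarrow> nat set" where
  "color_cuts G i j = {l. i l \<noteq> j \<and> (i l, j) \<notin> parcs G}"

definition color_block :: "'i pair_pre_digraph \<Rightarrow> (nat \<Rightarrow> 'i) \<Rightarrow> nat \<Rightarrow> 'i \<times> nat \<Rightarrow> nat set" where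
  "color_block G i m = (\<lambda>(j, t). cut_block {l. i l = j} (color_cuts G i j) m t)"

text \<open>For two positions of equal colour, the arc condition says that no position in between is
  a cut for that colour, that is, that equally many cuts precede both. In this form the classes can
  be read off as fibres.\<close>

lemma ker_rel_iff:
  "(k, k') \<in> ker_rel G m i \<longleftrightarrow> k \<in> {1..m} \<and> k' \<in> {1..m} \<and> i k = i k' \<and>
     cuts_before (color_cuts G i (i k)) k = cuts_before (color_cuts G i (i k)) k'"
proof (cases "k \<in> {1..m} \<and> k' \<in> {1..m} \<and> i k = i k'")
  case True
  have "(k, k') \<in> ker_rel G m i \<longleftrightarrow>
      (\<forall>l. min k k' < l \<and> l < max k k' \<longrightarrow> l \<notin> color_cuts G i (i k))"
    using True by (auto simp: ker_rel_def color_cuts_def)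
  also have "\<dots> \<longleftrightarrow> cuts_before (color_cuts G i (i k)) (min k k')
      = cuts_before (color_cuts G i (i k)) (max k k')"
    using True by (intro cuts_before_eq_iff[symmetric]) (auto simp: color_cuts_def min_def)
  also have "\<dots> \<longleftrightarrow> cuts_before (color_cuts G i (i k)) k = cuts_before (color_cuts G i (i k)) k'"
    by (auto simp: min_def max_def)
  finally show ?thesis using True by simp
qed (auto simp: ker_rel_def)

lemma color_block_subset: "color_block G i m (j, t) \<subseteq> {k \<in> {1..m}. i k = j}"
  by (auto simp: color_block_def cut_block_def)

lemma mem_color_blockD:
  "k \<in> color_block G i m p \<Longrightarrow> p = (i k, cuts_before (color_cuts G i (i k)) k)"
  by (auto simp: color_block_def cut_block_def split: prod.splits)

text \<open>The class of \<open>k\<close> is the block at its own colour and count. Counts of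
  positions up to \<open>m\<close> stay below or at \<open>m\<close>, and only nonempty blocks arise
  as classes.\<close>

lemma ker_partition_eq_color_blocks:
  assumes "i ` {1..m} \<subseteq> J"
  shows "ker_partition G m i = color_block G i m ` {p \<in> J \<times> {..m}. color_block G i m p \<noteq> {}}"
proof -
  have cls: "ker_rel G m i `` {k}
      = color_block G i m (i k, cuts_before (color_cuts G i (i k)) k)" if "k \<in> {1..m}" for k
    using that by (auto simp: ker_rel_iff color_block_def cut_block_def)
  have le: "cuts_before c k \<le> m" if "k \<in> {1..m}" for c k
  proof -
    have "cuts_before c k \<le> card {1..<k}" unfolding cuts_before_def by (intro card_mono) auto
    also have "card {1..<k} \<le> m" using that by simp linarith
    finally show ?thesis .
  qed
  show ?thesis
  proof (intro equalityI subsetI)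
    fix B assume "B \<in> ker_partition G m i"
    then obtain k where k: "k \<in> {1..m}" and B: "B = ker_rel G m i `` {k}"
      by (auto simp: ker_partition_def quotient_def)
    have "k \<in> B" using k by (simp add: B ker_rel_iff)
    then show "B \<in> color_block G i m ` {p \<in> J \<times> {..m}. color_block G i m p \<noteq> {}}"
      using k assms le[OF k] unfolding B cls[OF k] by (intro imageI) auto
  next
    fix B assume "B \<in> color_block G i m ` {p \<in> J \<times> {..m}. color_block G i m p \<noteq> {}}"
    then obtain j t k where B: "B = color_block G i m (j, t)" and k: "k \<in> B" by auto
    then have "k \<in> {1..m}" "i k = j" "cuts_before (color_cuts G i j) k = t"
      by (auto simp: color_block_def cut_block_def)
    then have "B = ker_rel G m i `` {k}" "k \<in> {1..m}" using cls[of k] B by simp_all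
    then show "B \<in> ker_partition G m i" by (auto simp: ker_partition_def quotient_def)
  qed
qed

text \<open>Any member of a block recovers its colour and segment, so the nonempty blocks are listed
  without repetition; f {} = 1 lets the empty ones join the product.\<close>

lemma prod_ker_partition:
  assumes "i ` {1..m} \<subseteq> J" "finite J" and "f {} = (1 :: complex)"
  shows "(\<Prod>B\<in>ker_partition G m i. f B) = (\<Prod>j\<in>J. \<Prod>t\<le>m. f (color_block G i m (j, t)))"
proof -
  let ?D = "{p \<in> J \<times> {..m}. color_block G i m p \<noteq> {}}"
  have inj: "inj_on (color_block G i m) ?D"
  proof (rule inj_onI)
    fix p q assume p: "p \<in> ?D" and eq: "color_block G i m p = color_block G i m q"
    from p obtain k where k: "k \<in> color_block G i m p" by auto
    then show "p = q" using mem_color_blockD[OF k] mem_color_blockD[of k G i m q] eq by simp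
  qed
  have "(\<Prod>B\<in>ker_partition G m i. f B) = (\<Prod>p\<in>?D. f (color_block G i m p))"
    unfolding ker_partition_eq_color_blocks[OF assms(1)] prod.reindex[OF inj] o_def by (rule refl)
  also have "\<dots> = (\<Prod>p\<in>J \<times> {..m}. f (color_block G i m p))"
    by (rule prod.mono_neutral_left) (use assms in auto)
  also have "\<dots> = (\<Prod>j\<in>J. \<Prod>t\<le>m. f (color_block G i m (j, t)))"
    by (simp add: prod.cartesian_product)
  finally show ?thesis .
qed

section \<open>Algebra of tensor operators\<close>

context hilbert_tensor_product
begin

lemma tensor_operator_cong:
  assumes "\<And>j. j \<in> J \<Longrightarrow> A j = B j"
  shows "tensor_operator J H K tens A = tensor_operator J H K tens B"
proof -
  have "coordinatewise A x = coordinatewise B x" for x using assms by auto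
  then show ?thesis by (simp add: tensor_operator_def)
qed

lemma compose_tensor_operator:
  assumes A: "\<And>j. j \<in> J \<Longrightarrow> A j \<in> bounded_operators (H j)"
    and B: "\<And>j. j \<in> J \<Longrightarrow> B j \<in> bounded_operators (H j)"
  shows "compose (carrier K) (tensor_operator J H K tens A) (tensor_operator J H K tens B)
    = tensor_operator J H K tens (\<lambda>j. compose (carrier (H j)) (A j) (B j))"
proof (rule tensor_operator_eqI[symmetric])
  show "compose (carrier K) (tensor_operator J H K tens A) (tensor_operator J H K tens B)
      \<in> bounded_operators K"
    by (intro K.compose_bounded tensor_operator_bounded A B)
  fix x assume x: "x \<in> product_vectors"
  interpret B: tensor_product_operators J H K tens B
    by unfold_locales (rule B)
  have "coordinatewise A (coordinatewise B x) = coordinatewise (\<lambda>j. compose (carrier (H j)) (A j) (B j)) x"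
    using x by (auto simp: compose_def product_vector_component)
  moreover have "compose (carrier K) (tensor_operator J H K tens A) (tensor_operator J H K tens B) (tens x)
      = tensor_operator J H K tens A (tensor_operator J H K tens B (tens x))"
    using x by (simp add: compose_def)
  ultimately show "compose (carrier K) (tensor_operator J H K tens A) (tensor_operator J H K tens B) (tens x)
      = tens (coordinatewise (\<lambda>j. compose (carrier (H j)) (A j) (B j)) x)"
    by (simp only: tensor_operator_tens[OF B x]
        tensor_operator_tens[OF A B.coordinatewise_closeds(1)[OF x]])
qed

lemma coordinatewise_upd:
  "i \<in> J \<Longrightarrow> coordinatewise (A(i := T)) x = (coordinatewise A x)(i := T (x i))"
  by auto

text \<open>Linearity of \<open>tens\<close> in slot \<open>i\<close>, carried over to operators
  through their values on elementary tensors.\<close>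

lemma tensor_operator_upd:
  assumes A: "\<And>j. j \<in> J \<Longrightarrow> A j \<in> bounded_operators (H j)" and i: "i \<in> J"
    and S: "S \<in> bounded_operators (H i)" and T: "T \<in> bounded_operators (H i)"
  shows tensor_operator_upd_add:
      "tensor_operator J H K tens (A(i := \<lambda>x\<in>carrier (H i). S x \<oplus>\<^bsub>H i\<^esub> T x))
        = (\<lambda>x\<in>carrier K. tensor_operator J H K tens (A(i := S)) x
            \<oplus>\<^bsub>K\<^esub> tensor_operator J H K tens (A(i := T)) x)"
    and tensor_operator_upd_smult:
      "tensor_operator J H K tens (A(i := \<lambda>x\<in>carrier (H i). c \<odot>\<^bsub>H i\<^esub> S x))
        = (\<lambda>x\<in>carrier K. c \<odot>\<^bsub>K\<^esub> tensor_operator J H K tens (A(i := S)) x)"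
proof -
  interpret Hi: complex_hilbert_space "H i" by (rule hilbert_factor[OF i])
  interpret A: tensor_product_operators J H K tens A
    by unfold_locales (rule A)
  have upd: "(A(i := R)) j \<in> bounded_operators (H j)"
    if "R \<in> bounded_operators (H i)" "j \<in> J" for R j
    using that A by auto
  note bdd = tensor_operator_bounded[OF upd]
  have tens_upd: "tensor_operator J H K tens (A(i := R)) (tens x)
      = tens ((coordinatewise A x)(i := R (x i)))"
    if "R \<in> bounded_operators (H i)" "x \<in> product_vectors" for R x
    unfolding coordinatewise_upd[OF i, of A R x, symmetric]
    by (rule tensor_operator_tens[OF upd[OF that(1)] that(2)])
  show "tensor_operator J H K tens (A(i := \<lambda>x\<in>carrier (H i). S x \<oplus>\<^bsub>H i\<^esub> T x))
      = (\<lambda>x\<in>carrier K. tensor_operator J H K tens (A(i := S)) x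
          \<oplus>\<^bsub>K\<^esub> tensor_operator J H K tens (A(i := T)) x)"
  proof (rule bounded_operator_eqI_tens)
    fix x assume x: "x \<in> product_vectors"
    have "x i \<in> carrier (H i)" using x i by (rule product_vector_component)
    then show "tensor_operator J H K tens (A(i := \<lambda>x\<in>carrier (H i). S x \<oplus>\<^bsub>H i\<^esub> T x)) (tens x)
      = (\<lambda>x\<in>carrier K. tensor_operator J H K tens (A(i := S)) x
          \<oplus>\<^bsub>K\<^esub> tensor_operator J H K tens (A(i := T)) x) (tens x)"
      using x S T
      by (simp add: tens_upd tens_add[OF A.coordinatewise_closeds(1)[OF x] i] Hi.bounded_operator_closed)
  qed (intro bdd K.add_operator_bounded Hi.add_operator_bounded S T; assumption)+
  show "tensor_operator J H K tens (A(i := \<lambda>x\<in>carrier (H i). c \<odot>\<^bsub>H i\<^esub> S x))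
      = (\<lambda>x\<in>carrier K. c \<odot>\<^bsub>K\<^esub> tensor_operator J H K tens (A(i := S)) x)"
  proof (rule bounded_operator_eqI_tens)
    fix x assume x: "x \<in> product_vectors"
    have "x i \<in> carrier (H i)" using x i by (rule product_vector_component)
    then show "tensor_operator J H K tens (A(i := \<lambda>x\<in>carrier (H i). c \<odot>\<^bsub>H i\<^esub> S x)) (tens x)
      = (\<lambda>x\<in>carrier K. c \<odot>\<^bsub>K\<^esub> tensor_operator J H K tens (A(i := S)) x) (tens x)"
      using x S
      by (simp add: tens_upd tens_smult[OF A.coordinatewise_closeds(1)[OF x] i] Hi.bounded_operator_closed)
  qed (intro bdd K.smult_operator_bounded Hi.smult_operator_bounded S; assumption)+
qed

text \<open>On the left \<open>foldr\<close> multiplies operators on \<open>K\<close>; on the right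
  it applies letters to a vector in each factor. Comparing images of elementary tensors avoids
  forming products of the families.\<close>

lemma foldr_compose_tensor_operators:
  assumes C: "\<And>k j. k \<in> set ks \<Longrightarrow> j \<in> J \<Longrightarrow> C k j \<in> bounded_operators (H j)"
    and x: "x \<in> product_vectors"
  shows "foldr (compose (carrier K)) (map (\<lambda>k. tensor_operator J H K tens (C k)) ks) (id_operator K) (tens x)
    = tens (\<lambda>j\<in>J. foldr (\<lambda>k. C k j) ks (x j))"
  using C
proof (induction ks)
  case Nil
  then show ?case using x by (simp add: id_operator_def)
next
  case (Cons k ks)
  let ?y = "\<lambda>j\<in>J. foldr (\<lambda>k. C k j) ks (x j)"
  have Ck: "\<And>j. j \<in> J \<Longrightarrow> C k j \<in> bounded_operators (H j)" using Cons.prems by simp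
  have y: "?y \<in> product_vectors"
    using Cons.prems product_vector_component[OF x]
    by (auto intro!: complex_hilbert_space.foldr_operators_closed hilbert_factor)
  have "foldr (compose (carrier K)) (map (\<lambda>k. tensor_operator J H K tens (C k)) (k # ks)) (id_operator K) (tens x)
      = tensor_operator J H K tens (C k) (foldr (compose (carrier K))
          (map (\<lambda>k. tensor_operator J H K tens (C k)) ks) (id_operator K) (tens x))"
    using x by (simp add: compose_eq)
  also have "\<dots> = tensor_operator J H K tens (C k) (tens ?y)"
    using Cons.prems by (subst Cons.IH) simp_all
  also have "\<dots> = tens (coordinatewise (C k) ?y)" by (rule tensor_operator_tens[OF Ck y])
  also have "coordinatewise (C k) ?y = (\<lambda>j\<in>J. foldr (\<lambda>k. C k j) (k # ks) (x j))" by auto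
  finally show ?case .
qed

end

section \<open>Identity and projection as self-adjoint idempotents\<close>

context complex_hilbert_space
begin

lemma adjoint_id_operator: "adjoint_operator H (id_operator H) = id_operator H"
  by (rule adjoint_operatorI[OF id_operator_bounded]) (simp add: id_operator_def)

lemma adjoint_rank_one_projection:
  "\<xi> \<in> carrier H \<Longrightarrow> adjoint_operator H (rank_one_projection H \<xi>) = rank_one_projection H \<xi>"
  by (rule adjoint_operatorI[OF rank_one_projection_bounded])
    (use hinner_commute[of \<xi>] in \<open>auto simp: rank_one_projection_def hinner_simps\<close>)

lemma compose_id_operator: "compose (carrier H) (id_operator H) (id_operator H) = id_operator H"
  by (auto simp: compose_def id_operator_def)

lemma compose_rank_one_projection:
  "\<xi> \<in> carrier H \<Longrightarrow> hnorm H \<xi> = 1 \<Longrightarrow>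
    compose (carrier H) (rank_one_projection H \<xi>) (rank_one_projection H \<xi>) = rank_one_projection H \<xi>"
  by (auto simp: compose_def rank_one_projection_def hinner_simps hinner_self)

end

section \<open>BMT independence\<close>

locale BMT_tensor_product = hilbert_tensor_product J H K tens
  for J :: "nat set" and H :: "nat \<Rightarrow> ('a, 'm) hilbert_scheme" and K :: "('b, 'n) hilbert_scheme"
    and tens :: "(nat \<Rightarrow> 'a) \<Rightarrow> 'b" +
  fixes G :: "nat pair_pre_digraph" and \<xi> :: "nat \<Rightarrow> 'a"
  assumes digraph: "nonempty_digraph G" and verts: "pverts G = J"
    and unit: "\<And>j. j \<in> J \<Longrightarrow> \<xi> j \<in> carrier (H j)" "\<And>j. j \<in> J \<Longrightarrow> hnorm (H j) (\<xi> j) = 1"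
begin

definition component :: "nat \<Rightarrow> ('a \<Rightarrow> 'a) \<Rightarrow> nat \<Rightarrow> 'a \<Rightarrow> 'a" where
  "component i A j = (if j = i then A else if (i, j) \<in> parcs G then id_operator (H j)
     else rank_one_projection (H j) (\<xi> j))"

abbreviation rep :: "nat \<Rightarrow> ('a \<Rightarrow> 'a) \<Rightarrow> 'b \<Rightarrow> 'b" where
  "rep \<equiv> BMT_rep G H \<xi> K tens"

lemma rep_eq: "rep i A = tensor_operator J H K tens (component i A)"
  by (simp add: BMT_rep_def component_def[abs_def] verts)

lemma component_bounded:
  "A \<in> bounded_operators (H i) \<Longrightarrow> j \<in> J \<Longrightarrow> component i A j \<in> bounded_operators (H j)"
  by (simp add: component_def complex_hilbert_space.id_operator_bounded hilbert_factor
      complex_hilbert_space.rank_one_projection_bounded unit)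

text \<open>Only slot \<open>i\<close> depends on the represented operator, so linearity of the
  representation reduces to linearity of a tensor operator in one slot.\<close>

lemma component_upd: "component i A = (component i B)(i := A)"
  by (auto simp: component_def)

text \<open>Products and stars are respected because every slot other than \<open>i\<close> carries
  a self-adjoint idempotent; sums and scalars take place in slot \<open>i\<close> alone.\<close>

lemma rep_star_hom:
  assumes i: "i \<in> J"
  shows "rep i \<in> star_hom (B_algebra (H i)) (B_algebra K)"
proof -
  interpret Hi: complex_hilbert_space "H i" by (rule hilbert_factor[OF i])
  have closed: "rep i S \<in> bounded_operators K" if "S \<in> bounded_operators (H i)" for S
    unfolding rep_eq by (intro tensor_operator_bounded component_bounded that)
  \<comment> \<open>The identity is a placeholder, overwritten in slot \<open>i\<close>; it supplies
    the bounded family in which one slot is varied.\<close>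
  have rep_upd: "rep i R = tensor_operator J H K tens ((component i (id_operator (H i)))(i := R))" for R
    unfolding rep_eq by (subst component_upd) (rule refl)
  have add: "rep i (\<lambda>x\<in>carrier (H i). S x \<oplus>\<^bsub>H i\<^esub> T x) = (\<lambda>x\<in>carrier K. rep i S x \<oplus>\<^bsub>K\<^esub> rep i T x)"
    and smult: "rep i (\<lambda>x\<in>carrier (H i). c \<odot>\<^bsub>H i\<^esub> S x) = (\<lambda>x\<in>carrier K. c \<odot>\<^bsub>K\<^esub> rep i S x)"
    if S: "S \<in> bounded_operators (H i)" and T: "T \<in> bounded_operators (H i)" for S T c
    unfolding rep_upd
    by (rule tensor_operator_upd[OF component_bounded[OF Hi.id_operator_bounded] i S T]; assumption)+
  have mult: "rep i (compose (carrier (H i)) S T) = compose (carrier K) (rep i S) (rep i T)"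
    if S: "S \<in> bounded_operators (H i)" and T: "T \<in> bounded_operators (H i)" for S T
  proof -
    have "compose (carrier K) (rep i S) (rep i T)
        = tensor_operator J H K tens (\<lambda>j. compose (carrier (H j)) (component i S j) (component i T j))"
      unfolding rep_eq by (intro compose_tensor_operator component_bounded S T)
    also have "\<dots> = rep i (compose (carrier (H i)) S T)"
      unfolding rep_eq by (rule tensor_operator_cong)
        (simp add: component_def complex_hilbert_space.compose_id_operator hilbert_factor unit
          complex_hilbert_space.compose_rank_one_projection)
    finally show ?thesis by (rule sym)
  qed
  have star: "rep i (adjoint_operator (H i) S) = adjoint_operator K (rep i S)"
    if S: "S \<in> bounded_operators (H i)" for S
  proof -
    have "adjoint_operator K (rep i S)
        = tensor_operator J H K tens (\<lambda>j. adjoint_operator (H j) (component i S j))"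
      unfolding rep_eq by (intro adjoint_tensor_operator component_bounded S)
    also have "\<dots> = rep i (adjoint_operator (H i) S)"
      unfolding rep_eq by (rule tensor_operator_cong)
        (simp add: component_def complex_hilbert_space.adjoint_id_operator hilbert_factor unit
          complex_hilbert_space.adjoint_rank_one_projection)
    finally show ?thesis by (rule sym)
  qed
  show ?thesis
    unfolding star_hom_def Hi.B_algebra_simps K.B_algebra_simps
    using closed add smult mult star by auto
qed

lemma rep_image_star_subalgebra:
  assumes i: "i \<in> J"
  shows "star_subalgebra (rep i ` carrier (B_algebra (H i))) (B_algebra K)"
proof -
  interpret Hi: complex_hilbert_space "H i" by (rule hilbert_factor[OF i])
  show ?thesis
    by (rule star_hom_image_star_subalgebra[OF Hi.B_algebra_complex_algebra
          K.B_algebra_complex_algebra rep_star_hom[OF i]])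
      (simp add: Hi.B_algebra_simps)
qed

section \<open>Vacuum expectations\<close>

abbreviation vacuum :: 'b where
  "vacuum \<equiv> tens (\<lambda>j\<in>J. \<xi> j)"

lemma vacuum_vector: "(\<lambda>j\<in>J. \<xi> j) \<in> product_vectors"
  using unit by simp

lemma hnorm_vacuum: "hnorm K vacuum = 1"
  unfolding hnorm_tens[OF vacuum_vector] by (simp add: unit)

text \<open>The product sends the vacuum to another elementary tensor, so its expectation factors
  over \<open>J\<close>.\<close>

lemma vector_state_ordered_prod:
  assumes B: "finite B"
    and A: "\<And>k. k \<in> B \<Longrightarrow> A k \<in> bounded_operators (H (i k)) \<and> a k = rep (i k) (A k)"
  shows "vector_state K vacuum (ordered_prod (B_algebra K) a B) =
    (\<Prod>j\<in>J. hinner (H j) (foldr (\<lambda>k. component (i k) (A k) j) (sorted_list_of_set B) (\<xi> j)) (\<xi> j))"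
proof -
  let ?ks = "sorted_list_of_set B"
  let ?y = "\<lambda>j\<in>J. foldr (\<lambda>k. component (i k) (A k) j) ?ks (\<xi> j)"
  have bdd: "component (i k) (A k) j \<in> bounded_operators (H j)" if "k \<in> set ?ks" "j \<in> J" for k j
    using that A B by (auto intro: component_bounded)
  have "map a ?ks = map (\<lambda>k. tensor_operator J H K tens (component (i k) (A k))) ?ks"
    using A B by (simp add: rep_eq)
  then have "ordered_prod (B_algebra K) a B vacuum
      = tens (\<lambda>j\<in>J. foldr (\<lambda>k. component (i k) (A k) j) ?ks ((\<lambda>j\<in>J. \<xi> j) j))"
    unfolding ordered_prod_def K.B_algebra_simps
    using foldr_compose_tensor_operators[where C = "\<lambda>k. component (i k) (A k)", OF bdd vacuum_vector]
    by (simp only:)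
  also have "(\<lambda>j\<in>J. foldr (\<lambda>k. component (i k) (A k) j) ?ks ((\<lambda>j\<in>J. \<xi> j) j)) = ?y"
    by (rule restrict_ext) simp
  finally have prod: "ordered_prod (B_algebra K) a B vacuum = tens ?y" .
  have "?y \<in> product_vectors"
    using bdd unit by (auto intro!: complex_hilbert_space.foldr_operators_closed hilbert_factor)
  from hinner_tens[OF this vacuum_vector] show ?thesis
    unfolding vector_state_def prod by simp
qed

text \<open>Factor \<open>j\<close> of the full word splits along its cuts into blocks of colour
  \<open>j\<close>. On such a block every other factor contributes 1, so the expectation in
  \<open>K\<close> of the block equals that in factor \<open>j\<close>; this turns the product over
  factors and segments into one over the kernel partition.\<close>

lemma vector_state_factorises:
  assumes A: "\<And>k. k \<in> {1..m} \<Longrightarrow> i k \<in> J \<and> A k \<in> bounded_operators (H (i k)) \<and> a k = rep (i k) (A k)"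
  shows "vector_state K vacuum (ordered_prod (B_algebra K) a {1..m}) =
    (\<Prod>B\<in>ker_partition G m i. vector_state K vacuum (ordered_prod (B_algebra K) a B))"
proof -
  define T where "T j k = component (i k) (A k) j" for j k
  let ?\<phi> = "\<lambda>B. vector_state K vacuum (ordered_prod (B_algebra K) a B)"
  let ?\<phi>\<^sub>j = "\<lambda>j B. hinner (H j) (foldr (T j) (sorted_list_of_set B) (\<xi> j)) (\<xi> j)"
  have \<phi>: "?\<phi> B = (\<Prod>j\<in>J. ?\<phi>\<^sub>j j B)" if "B \<subseteq> {1..m}" for B
    unfolding T_def
    by (rule vector_state_ordered_prod) (use that A finite_subset in auto)
  have \<phi>\<^sub>j_trivial: "?\<phi>\<^sub>j j' B = 1" if B: "B \<subseteq> {k \<in> {1..m}. i k = j}" and j': "j' \<in> J" "j' \<noteq> j" for j j' B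
  proof -
    interpret Hj: complex_hilbert_space "H j'" by (rule hilbert_factor[OF j'(1)])
    have "finite B" using B finite_subset by fastforce
    \<comment> \<open>In factor \<open>j'\<close> a letter of another colour is the identity or the
      projection, and both fix \<open>\<xi> j'\<close>.\<close>
    then have "foldr (T j') (sorted_list_of_set B) (\<xi> j') = \<xi> j'"
      using B j' unit[OF j'(1)]
      by (intro Hj.foldr_operators_fixed)
        (auto simp: T_def component_def id_operator_def rank_one_projection_def Hj.hinner_self)
    then show ?thesis using unit[OF j'(1)] by (simp add: Hj.hinner_self)
  qed
  have \<phi>_block: "?\<phi> B = ?\<phi>\<^sub>j j B" if B: "B \<subseteq> {k \<in> {1..m}. i k = j}" and j: "j \<in> J" for j B
  proof -
    have "?\<phi> B = ?\<phi>\<^sub>j j B * (\<Prod>j'\<in>J - {j}. ?\<phi>\<^sub>j j' B)"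
      using B by (subst \<phi>) (auto simp: prod.remove[OF finite_index j])
    also have "(\<Prod>j'\<in>J - {j}. ?\<phi>\<^sub>j j' B) = 1"
      by (rule prod.neutral) (use \<phi>\<^sub>j_trivial[OF B] in auto)
    finally show ?thesis unfolding mult_1_right .
  qed
  have split: "?\<phi>\<^sub>j j {1..m} = (\<Prod>t\<le>m. ?\<phi>\<^sub>j j (color_block G i m (j, t)))" if j: "j \<in> J" for j
  proof -
    interpret Hj: complex_hilbert_space "H j" by (rule hilbert_factor[OF j])
    have "?\<phi>\<^sub>j j {1..m} = (\<Prod>t\<le>m. ?\<phi>\<^sub>j j (cut_block {l. i l = j} (color_cuts G i j) m t))"
    proof (rule Hj.hinner_word_eq_prod_blocks[OF unit[OF j]])
      show "{l. i l = j} \<inter> color_cuts G i j = {}" by (auto simp: color_cuts_def)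
      show "T j k \<in> bounded_operators (H j)" if "k \<in> {1..m}" for k
        unfolding T_def using A[OF that] j by (auto intro: component_bounded)
    qed (auto simp: T_def component_def color_cuts_def)
    then show ?thesis by (simp add: color_block_def)
  qed
  have "?\<phi> {1..m} = (\<Prod>j\<in>J. \<Prod>t\<le>m. ?\<phi>\<^sub>j j (color_block G i m (j, t)))"
    using \<phi>[OF order_refl] split by simp
  also have "\<dots> = (\<Prod>j\<in>J. \<Prod>t\<le>m. ?\<phi> (color_block G i m (j, t)))"
    by (intro prod.cong refl \<phi>_block[symmetric] color_block_subset)
  also have "\<dots> = (\<Prod>B\<in>ker_partition G m i. ?\<phi> B)"
  proof (rule prod_ker_partition[symmetric])
    \<comment> \<open>The product over colours and segments includes empty blocks, which must not
      contribute.\<close>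
    show "?\<phi> {} = 1"
      using K.hinner_self[OF tens_carrier[OF vacuum_vector]] tens_carrier[OF vacuum_vector]
      by (simp add: vector_state_def ordered_prod_def K.B_algebra_simps id_operator_def hnorm_vacuum)
  qed (use A finite_index in auto)
  finally show ?thesis .
qed

lemma rep_BMT_independent:
  "BMT_independent (B_algebra K) (vector_state K vacuum) G (\<lambda>i. rep i ` carrier (B_algebra (H i)))"
  unfolding BMT_independent_def verts
proof (intro conjI ballI allI impI)
  show "algebraic_probability_space (B_algebra K) (vector_state K vacuum)"
    by (rule K.vector_state_algebraic_probability_space[OF tens_carrier[OF vacuum_vector] hnorm_vacuum])
  show "nonempty_digraph G" by (rule digraph)
  show "nonunital_subalgebra (rep i ` carrier (B_algebra (H i))) (B_algebra K)" if "i \<in> J" for i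
    using rep_image_star_subalgebra[OF that] by (simp add: star_subalgebra_def)
next
  fix m :: nat and i a
  assume a: "\<forall>k\<in>{1..m}. i k \<in> J \<and> a k \<in> rep (i k) ` carrier (B_algebra (H (i k)))"
  \<comment> \<open>Each element is known only to lie in an image; a represented operator is chosen
    for every position.\<close>
  have "\<forall>k\<in>{1..m}. \<exists>A. A \<in> bounded_operators (H (i k)) \<and> a k = rep (i k) A"
  proof
    fix k assume k: "k \<in> {1..m}"
    with a have "i k \<in> J" and ak: "a k \<in> rep (i k) ` carrier (B_algebra (H (i k)))" by blast+
    then have "carrier (B_algebra (H (i k))) = bounded_operators (H (i k))"
      by (intro complex_hilbert_space.B_algebra_simps hilbert_factor)
    with ak show "\<exists>A. A \<in> bounded_operators (H (i k)) \<and> a k = rep (i k) A" by auto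
  qed
  from bchoice[OF this] obtain A where
    "\<forall>k\<in>{1..m}. A k \<in> bounded_operators (H (i k)) \<and> a k = rep (i k) (A k)" by blast
  with a show "vector_state K vacuum (ordered_prod (B_algebra K) a {1..m}) =
      (\<Prod>B\<in>ker_partition G m i. vector_state K vacuum (ordered_prod (B_algebra K) a B))"
    by (intro vector_state_factorises[where A = A]) auto
qed

end

theorem theorem4p4:
  fixes N :: nat
    and G :: "nat pair_pre_digraph"
    and H :: "nat \<Rightarrow> 'a hilbert"
    and \<xi> :: "nat \<Rightarrow> 'a"
    and K :: "'b hilbert"
    and tens :: "(nat \<Rightarrow> 'a) \<Rightarrow> 'b"
  assumes "nonempty_digraph G"
    and "pverts G = {1..N}"
    and "\<And>j. j \<in> {1..N} \<Longrightarrow> complex_hilbert_space (H j)"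
    and "\<And>j. j \<in> {1..N} \<Longrightarrow> \<xi> j \<in> carrier (H j) \<and> hnorm (H j) (\<xi> j) = 1"
    and "hilbert_tensor_product {1..N} H K tens"
  shows "(\<forall>i\<in>{1..N}. BMT_rep G H \<xi> K tens i \<in> star_hom (B_algebra (H i)) (B_algebra K) \<and>
             star_subalgebra (BMT_rep G H \<xi> K tens i ` carrier (B_algebra (H i))) (B_algebra K)) \<and>
         BMT_independent (B_algebra K) (vector_state K (tens (\<lambda>j\<in>{1..N}. \<xi> j))) G
           (\<lambda>i. BMT_rep G H \<xi> K tens i ` carrier (B_algebra (H i)))"
proof -
  interpret hilbert_tensor_product "{1..N}" H K tens by (rule assms(5))
  interpret BMT_tensor_product "{1..N}" H K tens G \<xi>
    by unfold_locales (use assms in auto)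
  show ?thesis
    using rep_star_hom rep_image_star_subalgebra rep_BMT_independent by blast
qed

end
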